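(* Consider a static team with a classical information structure, that is, with an expanding information structure so that $\sigma(y^n)\subset\sigma(y^{n+1})$ for $n\ge1$. Suppose further that $\prod_k(\mathbb{Y}^k\times\mathbb{U}^k)$ is compact. If $$\tilde c(y^1,\dots,y^N,u^1,\dots,u^N):=E[c(\omega_0,\mathbf{u})\mid\mathbf{y},\mathbf{u}]$$ is jointly lower semi-continuous in $\mathbf{u}=(u^1,\dots,u^N)$ for every $\mathbf{y}=(y^1,\dots,y^N)$, then there exists an optimal team policy, which is deterministic.
   Context: Static team: there are $N$ decision makers (DMs). $\Omega_0$, the measurement spaces $\mathbb{Y}^k$ and the action spaces $\mathbb{U}^k$ are standard Borel, and $(\omega_0,y^1,\dots,y^N)$ is a random vector in $\Omega_0\times\prod_k\mathbb{Y}^k$ with a fixed law $\mu$ not affected by the actions. DM $k$ observes $y^k$ and chooses $u^k\in\mathbb{U}^k$. A deterministic policy is a tuple $\underline\gamma=(\gamma^1,\dots,\gamma^N)$ of measurable maps $\gamma^k:\mathbb{Y}^k\to\mathbb{U}^k$, with $u^k=\gamma^k(y^k)$; an individually randomized policy is a tuple of stochastic kernels $\Pi^k(du^k\mid y^k)$ with actions drawn independently across DMs given $(\omega_0,y^1,\dots,y^N)$. The cost is $J(\underline\gamma)=E^{\underline\gamma}[c(\omega_0,\mathbf{u})]$ with $c:\Omega_0\times\prod_k\mathbb{U}^k\to\mathbb{R}_+$ measurable; a policy is optimal if it attains the infimum of $J$ over all policies. Since the team is static, $\tilde c(\mathbf{y},\mathbf{u})=\int c(\omega_0,\mathbf{u})\,\mu(d\omega_0\mid\mathbf{y})$,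 where $\mu(d\omega_0\mid\mathbf{y})$ is the regular conditional distribution of $\omega_0$ given $\mathbf{y}$. *)

theory Defs
  imports "HOL-Probability.Probability"
begin

text \<open>
  A standard Borel space is a Borel subset \<open>S\<close> of a complete separable metric space (an ambient
  type of class \<open>polish_space\<close>), with the relative topology \<open>top_of_set S\<close> and the \<open>\<sigma>\<close>-algebra
  \<open>borel_on S\<close>. The spaces \<open>Y 1, \<dots>, Y N\<close> may differ, but share one ambient type, and likewise
  \<open>U 1, \<dots>, U N\<close>. This is no loss of generality, since every standard Borel space embeds
  homeomorphically as a Borel subset of \<open>nat \<Rightarrow> real\<close>.

  Decision makers are numbered \<open>1, \<dots>, N\<close>; tuples are elements of \<open>\<Pi>\<^sub>E k\<in>{1..N}. _\<close>.
\<close>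

abbreviation borel_on :: "'a::topological_space set \<Rightarrow> 'a measure" where
  "borel_on S \<equiv> restrict_space borel S"

abbreviation borel_prod :: "nat \<Rightarrow> (nat \<Rightarrow> 'a::topological_space set) \<Rightarrow> (nat \<Rightarrow> 'a) measure" where
  "borel_prod N S \<equiv> (\<Pi>\<^sub>M k\<in>{1..N}. borel_on (S k))"

definition tuple :: "nat \<Rightarrow> (nat \<Rightarrow> 'w \<Rightarrow> 'y) \<Rightarrow> 'w \<Rightarrow> nat \<Rightarrow> 'y" where
  "tuple N y w = (\<lambda>k\<in>{1..N}. y k w)"

definition sigma_of :: "'w measure \<Rightarrow> 'y::topological_space set \<Rightarrow> ('w \<Rightarrow> 'y) \<Rightarrow> 'w set set" where
  "sigma_of P S f = sets (vimage_algebra (space P) f (borel_on S))"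

definition expanding_information ::
    "nat \<Rightarrow> 'w measure \<Rightarrow> (nat \<Rightarrow> 'y::topological_space set) \<Rightarrow> (nat \<Rightarrow> 'w \<Rightarrow> 'y) \<Rightarrow> bool" where
  "expanding_information N P Y y \<longleftrightarrow>
     (\<forall>n\<in>{1..<N}. sigma_of P (Y n) (y n) \<subseteq> sigma_of P (Y (Suc n)) (y (Suc n)))"

definition deterministic_policy ::
    "nat \<Rightarrow> (nat \<Rightarrow> 'y::topological_space set) \<Rightarrow> (nat \<Rightarrow> 'u::topological_space set)
      \<Rightarrow> (nat \<Rightarrow> 'y \<Rightarrow> 'u) \<Rightarrow> bool" where
  "deterministic_policy N Y U \<gamma> \<longleftrightarrow> (\<forall>k\<in>{1..N}. \<gamma> k \<in> borel_on (Y k) \<rightarrow>\<^sub>M borel_on (U k))"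

definition randomized_policy ::
    "nat \<Rightarrow> (nat \<Rightarrow> 'y::topological_space set) \<Rightarrow> (nat \<Rightarrow> 'u::topological_space set)
      \<Rightarrow> (nat \<Rightarrow> 'y \<Rightarrow> 'u measure) \<Rightarrow> bool" where
  "randomized_policy N Y U \<pi> \<longleftrightarrow>
     (\<forall>k\<in>{1..N}. \<pi> k \<in> borel_on (Y k) \<rightarrow>\<^sub>M prob_algebra (borel_on (U k)))"

text \<open>
  \<open>P\<close> is the probability measure of the underlying space on which the primitive random variables
  \<open>\<omega>0\<close> and \<open>y 1, \<dots>, y N\<close> are defined. Expected costs are extended nonnegative reals.
\<close>

definition cost_det ::
    "nat \<Rightarrow> 'w measure \<Rightarrow> ('w \<Rightarrow> 'o) \<Rightarrow> (nat \<Rightarrow> 'w \<Rightarrow> 'y) \<Rightarrow> ('o \<Rightarrow> (nat \<Rightarrow> 'u) \<Rightarrow> real)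
      \<Rightarrow> (nat \<Rightarrow> 'y \<Rightarrow> 'u) \<Rightarrow> ennreal" where
  "cost_det N P \<omega>0 y c \<gamma> =
     (\<integral>\<^sup>+ w. ennreal (c (\<omega>0 w) (\<lambda>k\<in>{1..N}. \<gamma> k (y k w))) \<partial>P)"

definition cost_rand ::
    "nat \<Rightarrow> 'w measure \<Rightarrow> ('w \<Rightarrow> 'o) \<Rightarrow> (nat \<Rightarrow> 'w \<Rightarrow> 'y) \<Rightarrow> ('o \<Rightarrow> (nat \<Rightarrow> 'u) \<Rightarrow> real)
      \<Rightarrow> (nat \<Rightarrow> 'y \<Rightarrow> 'u measure) \<Rightarrow> ennreal" where
  "cost_rand N P \<omega>0 y c \<pi> =
     (\<integral>\<^sup>+ w. (\<integral>\<^sup>+ u. ennreal (c (\<omega>0 w) u) \<partial>(\<Pi>\<^sub>M k\<in>{1..N}. \<pi> k (y k w))) \<partial>P)"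

definition optimal_deterministic_policy ::
    "nat \<Rightarrow> 'w measure \<Rightarrow> ('w \<Rightarrow> 'o) \<Rightarrow> (nat \<Rightarrow> 'y::topological_space set) \<Rightarrow> (nat \<Rightarrow> 'w \<Rightarrow> 'y)
      \<Rightarrow> (nat \<Rightarrow> 'u::topological_space set) \<Rightarrow> ('o \<Rightarrow> (nat \<Rightarrow> 'u) \<Rightarrow> real)
      \<Rightarrow> (nat \<Rightarrow> 'y \<Rightarrow> 'u) \<Rightarrow> bool" where
  "optimal_deterministic_policy N P \<omega>0 Y y U c \<gamma> \<longleftrightarrow>
     deterministic_policy N Y U \<gamma> \<and>
     cost_det N P \<omega>0 y c \<gamma> =
       Inf (cost_det N P \<omega>0 y c ` {\<gamma>'. deterministic_policy N Y U \<gamma>'} \<union>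
            cost_rand N P \<omega>0 y c ` {\<pi>. randomized_policy N Y U \<pi>})"

text \<open>
  \<open>\<kappa>\<close> is a version of the regular conditional distribution \<open>\<mu>(d\<omega>\<^sub>0 | y)\<close>: a stochastic kernel from
  the product of the \<open>Y k\<close> to \<open>\<Omega>0\<close> that disintegrates the joint law of \<open>\<omega>0\<close> and \<open>(y 1, \<dots>, y N)\<close>.
\<close>

definition regular_conditional_distribution ::
    "nat \<Rightarrow> 'w measure \<Rightarrow> 'o::topological_space set \<Rightarrow> ('w \<Rightarrow> 'o)
      \<Rightarrow> (nat \<Rightarrow> 'y::topological_space set) \<Rightarrow> (nat \<Rightarrow> 'w \<Rightarrow> 'y)
      \<Rightarrow> ((nat \<Rightarrow> 'y) \<Rightarrow> 'o measure) \<Rightarrow> bool" where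
  "regular_conditional_distribution N P \<Omega>0 \<omega>0 Y y \<kappa> \<longleftrightarrow>
     \<kappa> \<in> borel_prod N Y \<rightarrow>\<^sub>M prob_algebra (borel_on \<Omega>0) \<and>
     (\<forall>A\<in>sets (borel_on \<Omega>0). \<forall>B\<in>sets (borel_prod N Y).
        emeasure P {w \<in> space P. \<omega>0 w \<in> A \<and> tuple N y w \<in> B} =
          (\<integral>\<^sup>+ w. emeasure (\<kappa> (tuple N y w)) A * indicator B (tuple N y w) \<partial>P))"

definition conditional_cost ::
    "('o \<Rightarrow> (nat \<Rightarrow> 'u) \<Rightarrow> real) \<Rightarrow> ((nat \<Rightarrow> 'y) \<Rightarrow> 'o measure)
      \<Rightarrow> (nat \<Rightarrow> 'y) \<Rightarrow> (nat \<Rightarrow> 'u) \<Rightarrow> ennreal" where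
  "conditional_cost c \<kappa> ys us = (\<integral>\<^sup>+ x. ennreal (c x us) \<partial>(\<kappa> ys))"

definition lower_semicontinuous_map :: "'a topology \<Rightarrow> ('a \<Rightarrow> ennreal) \<Rightarrow> bool" where
  "lower_semicontinuous_map X f \<longleftrightarrow> (\<forall>a. openin X {x \<in> topspace X. a < f x})"

end

theory Submission
  imports Defs
begin

text \<open>
  The infimum of the cost is attained because a minimising sequence of deterministic policies
  \<open>\<Gamma> 0, \<Gamma> 1, \<dots>\<close> can be made to converge pointwise along a subsequence that depends on the
  observations. Decision maker \<open>k\<close> may choose the subsequence as a function of \<open>y k\<close>, and, because the
  information expands, the later decision makers know that choice and can refine it; so the limiting
  actions are again functions of the right observations.

  The danger is that a subsequence that depends on the observations raises the expected cost: on the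
  observations where it selects \<open>\<Gamma> j\<close>, the policy \<open>\<Gamma> j\<close> may be particularly bad. The remedy
  (\<open>conditional_subsequence\<close>) is to select only indices at which the conditional expectation
  \<open>Z j\<close> of the cost given the \<open>\<sigma>\<close>-algebra of the current decision maker is at most
  \<open>liminf Z + 1/m\<close>. By Fatou's lemma the expected costs along the new sequence then have
  a limit inferior no larger than before. Iterating over the decision makers
  (\<open>adapted_subsequence\<close>) yields random indices \<open>\<sigma> m\<close> along which all actions converge.
  For the last step, lower semicontinuity of the conditional cost in the actions and Fatou's lemma
  show that the limiting policy costs no more than the infimum. Everything that has to be chosen
  measurably along the way is a least index in \<open>\<nat>\<close>.

  Two standard facts connect this with policies. An action that is measurable with respect to the
  \<open>\<sigma>\<close>-algebra of \<open>y k\<close> is a measurable function of \<open>y k\<close> (\<open>doob_dynkin_factorization\<close>). A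
  stochastic kernel is the law of a measurable function of its parameter and an independent uniform seed
  (\<open>kernel_randomization\<close>), whence a randomised policy is a mixture of deterministic ones and
  costs at least their infimum (\<open>cost_rand_ge_INF_cost_det\<close>). Both rest on one device:
  a point of a Polish space is recovered, in a Borel way, from countably many bits
  (\<open>polish_bit_code\<close>).
\<close>

section \<open>Coding a Polish space by countably many bits\<close>

text \<open>
  The operator \<open>lim\<close> has one and the same unspecified value at all divergent sequences; replacing
  these by the constant sequence at that value makes every sequence convergent and leaves \<open>lim\<close>
  unchanged.
\<close>

lemma borel_measurable_lim_polish:
  fixes f :: "nat \<Rightarrow> 'a \<Rightarrow> 'b::polish_space"
  assumes [measurable]: "\<And>i. f i \<in> borel_measurable M"
  shows "(\<lambda>x. lim (\<lambda>i. f i x)) \<in> borel_measurable M"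
proof (rule borel_measurable_LIMSEQ_metric)
  \<comment> \<open>the value of \<open>lim\<close> at every divergent sequence\<close>
  define z :: 'b where "z = (THE L. False)"
  define g where "g i x = (if Cauchy (\<lambda>i. f i x) then f i x else z)" for i x
  show "g i \<in> borel_measurable M" for i
    unfolding g_def by measurable
  fix x
  show "(\<lambda>i. g i x) \<longlonglongrightarrow> lim (\<lambda>i. f i x)"
  proof (cases "Cauchy (\<lambda>i. f i x)")
    case True
    then show ?thesis
      by (simp add: g_def Cauchy_convergent_iff convergent_LIMSEQ_iff)
  next
    case False
    then have "lim (\<lambda>i. f i x) = z"
      by (auto simp: lim_def z_def Cauchy_convergent_iff convergent_def)
    with False show ?thesis
      by (simp add: g_def)
  qed
qed

text \<open>
  The bits record membership in the balls of radius \<open>(1/2)^i\<close> around the points of a dense sequence.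
  Decoding picks, for each \<open>i\<close>, the first centre whose ball contains the point; these centres converge
  to it. Decoding is defined and measurable on all bit sequences, so it never has to be decided
  which sequences are codes.
\<close>

lemma polish_bit_code:
  obtains B :: "nat \<Rightarrow> 'b::polish_space set" and d :: "(nat \<Rightarrow> bool) \<Rightarrow> 'b"
  where "\<And>n. open (B n)" "\<And>u. d (\<lambda>n. u \<in> B n) = u"
    "d \<in> borel_measurable (\<Pi>\<^sub>M n\<in>UNIV. count_space UNIV)"
proof -
  obtain D :: "'b set" where D: "countable D" "\<And>X. open X \<Longrightarrow> X \<noteq> {} \<Longrightarrow> \<exists>x\<in>D. x \<in> X"
    by (erule countable_dense_setE)
  define q where "q = from_nat_into D"
  have "D \<noteq> {}"
    using D(2)[of UNIV] by auto
  then have q: "\<exists>l. q l \<in> X" if "open X" "X \<noteq> {}" for X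
    using D(2)[OF that] D(1) by (metis from_nat_into_surj q_def)
  define B where "B n = (case prod_decode n of (i, l) \<Rightarrow> ball (q l) ((1/2)^i))" for n
  define d where "d b = lim (\<lambda>i. q (LEAST l. b (prod_encode (i, l))))" for b
  show thesis
  proof
    show "open (B n)" for n
      by (auto simp: B_def split: prod.split)
    show "d (\<lambda>n. u \<in> B n) = u" for u
    proof -
      have "dist (q (LEAST l. u \<in> B (prod_encode (i, l)))) u < (1/2)^i" for i
      proof -
        have "\<exists>l. u \<in> B (prod_encode (i, l))"
          using q[of "ball u ((1/2)^i)"] by (auto simp: B_def dist_commute not_le)
        then have "u \<in> B (prod_encode (i, LEAST l. u \<in> B (prod_encode (i, l))))"
          by (rule LeastI_ex)
        then show ?thesis
          by (simp add: B_def)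
      qed
      then have "(\<lambda>i. dist (q (LEAST l. u \<in> B (prod_encode (i, l)))) u) \<longlonglongrightarrow> 0"
        by (intro real_tendsto_sandwich[OF _ _ tendsto_const LIMSEQ_realpow_zero[of "1/2"]])
          (auto intro: less_imp_le always_eventually)
      then have "(\<lambda>i. q (LEAST l. u \<in> B (prod_encode (i, l)))) \<longlonglongrightarrow> u"
        by (rule tendsto_dist_iff[THEN iffD2])
      then show ?thesis
        unfolding d_def by (rule limI)
    qed
    have [measurable]: "(\<lambda>b. b n) \<in> (\<Pi>\<^sub>M n\<in>UNIV. count_space UNIV) \<rightarrow>\<^sub>M count_space (UNIV :: bool set)" for n :: nat
      by (rule measurable_component_singleton) simp
    show "d \<in> borel_measurable (\<Pi>\<^sub>M n\<in>UNIV. count_space UNIV)"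
      unfolding d_def
    proof (rule borel_measurable_lim_polish)
      show "(\<lambda>b. q (LEAST l. b (prod_encode (i, l)))) \<in> borel_measurable (\<Pi>\<^sub>M n\<in>UNIV. count_space UNIV)" for i
        by (rule measurable_compose[OF measurable_Least]) auto
    qed
  qed
qed

text \<open>
  Each bit of \<open>f w\<close> is an event of the form \<open>g w \<in> A n\<close>; decoding the bits \<open>z \<in> A n\<close> gives the
  factor \<open>h\<close>.
\<close>

lemma doob_dynkin_factorization:
  fixes f :: "'w \<Rightarrow> 'b::polish_space"
  assumes g: "g \<in> \<Omega> \<rightarrow> space M" and f: "f \<in> borel_measurable (vimage_algebra \<Omega> g M)"
  obtains h where "h \<in> borel_measurable M" "\<And>w. w \<in> \<Omega> \<Longrightarrow> h (g w) = f w"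
proof -
  obtain B :: "nat \<Rightarrow> 'b set" and d where B: "\<And>n. open (B n)" "\<And>u. d (\<lambda>n. u \<in> B n) = u"
    and d: "d \<in> borel_measurable (\<Pi>\<^sub>M n\<in>UNIV. count_space UNIV)"
    by (rule polish_bit_code) (rule that, assumption+)
  have "\<exists>A. A \<in> sets M \<and> f -` B n \<inter> \<Omega> = g -` A \<inter> \<Omega>" for n
    using measurable_sets[OF f, of "B n"] B(1)[of n] by (auto simp: sets_vimage_algebra2[OF g])
  then obtain A where A: "\<And>n. A n \<in> sets M" "\<And>n. f -` B n \<inter> \<Omega> = g -` A n \<inter> \<Omega>"
    by metis
  show thesis
  proof
    show "(\<lambda>y. d (\<lambda>n. y \<in> A n)) \<in> borel_measurable M"
      using A(1) by (intro measurable_compose[OF _ d] measurable_PiM_single') (auto simp: PiE_UNIV_domain)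
    show "d (\<lambda>n. g w \<in> A n) = f w" if "w \<in> \<Omega>" for w
    proof -
      have "g w \<in> A n \<longleftrightarrow> f w \<in> B n" for n
        using A(2)[of n] that by blast
      then show ?thesis
        by (simp add: B(2))
    qed
  qed
qed

section \<open>Random subsequences\<close>

primrec successive_hits :: "(nat \<Rightarrow> nat \<Rightarrow> 'w \<Rightarrow> bool) \<Rightarrow> nat \<Rightarrow> 'w \<Rightarrow> nat" where
  "successive_hits R 0 w = (LEAST j. R 0 j w)"
| "successive_hits R (Suc m) w = (LEAST j. successive_hits R m w < j \<and> R (Suc m) j w)"

text \<open>
  Least indices are measurable, so a property that holds infinitely often can be met along a
  subsequence chosen measurably.
\<close>

lemma measurable_random_subsequence:
  assumes R[measurable]: "\<And>i j. Measurable.pred G (R i j)"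
    and io: "\<And>i w. w \<in> space G \<Longrightarrow> \<exists>\<^sub>\<infinity>j. R i j w"
  obtains \<tau> :: "nat \<Rightarrow> 'w \<Rightarrow> nat" where
    "\<And>m. \<tau> m \<in> G \<rightarrow>\<^sub>M count_space UNIV"
    "\<And>w. w \<in> space G \<Longrightarrow> strict_mono (\<lambda>m. \<tau> m w)"
    "\<And>m w. w \<in> space G \<Longrightarrow> R m (\<tau> m w) w"
proof
  show "successive_hits R m \<in> G \<rightarrow>\<^sub>M count_space UNIV" for m
  proof (induction m)
    case (Suc m)
    note Suc[measurable]
    show ?case unfolding successive_hits.simps by measurable
  qed (unfold successive_hits.simps, measurable)
  have Suc: "successive_hits R m w < successive_hits R (Suc m) w \<and>
      R (Suc m) (successive_hits R (Suc m) w) w" if "w \<in> space G" for m w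
    unfolding successive_hits.simps
    by (rule LeastI_ex) (use io[OF that] in \<open>auto simp: INFM_nat\<close>)
  then show "strict_mono (\<lambda>m. successive_hits R m w)" if "w \<in> space G" for w
    using that by (simp add: strict_mono_Suc_iff)
  show "R m (successive_hits R m w) w" if "w \<in> space G" for m w
  proof (cases m)
    case 0
    show ?thesis
      unfolding 0 successive_hits.simps by (rule LeastI_ex) (use io[OF that] in \<open>auto simp: INFM_nat\<close>)
  qed (use Suc[OF that] in blast)
qed

text \<open>
  A measurable bisection: \<open>nested_ball q v i j w\<close> says that \<open>v j w\<close> lies in \<open>i\<close> successively chosen
  balls. The next ball has radius \<open>(1/2)^i\<close>, and its centre is the first \<open>q i l\<close> for which
  infinitely many terms of the sequence lie in it and in all the balls chosen before.
\<close>

primrec nested_ball :: "(nat \<Rightarrow> nat \<Rightarrow> 'u::metric_space) \<Rightarrow> (nat \<Rightarrow> 'w \<Rightarrow> 'u) \<Rightarrow> nat \<Rightarrow> nat \<Rightarrow> 'w \<Rightarrow> bool" where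
  "nested_ball q v 0 j w \<longleftrightarrow> True"
| "nested_ball q v (Suc i) j w \<longleftrightarrow> nested_ball q v i j w \<and>
     dist (q i (LEAST l. \<exists>\<^sub>\<infinity>j. nested_ball q v i j w \<and> dist (q i l) (v j w) < (1/2)^i)) (v j w) < (1/2)^i"

text \<open>
  Compactness provides finitely many balls at each stage, so that one of them keeps infinitely many
  terms. A subsequence whose \<open>m\<close>-th term lies in the first \<open>m\<close> balls is Cauchy.
\<close>

lemma measurable_bolzano_weierstrass:
  fixes v :: "nat \<Rightarrow> 'w \<Rightarrow> 'u::polish_space"
  assumes K: "compact K"
    and v[measurable]: "\<And>j. v j \<in> borel_measurable G"
    and vK: "\<And>j w. w \<in> space G \<Longrightarrow> v j w \<in> K"
  obtains \<tau> :: "nat \<Rightarrow> 'w \<Rightarrow> nat" and l where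
    "\<And>m. \<tau> m \<in> G \<rightarrow>\<^sub>M count_space UNIV"
    "\<And>w. w \<in> space G \<Longrightarrow> strict_mono (\<lambda>m. \<tau> m w)"
    "l \<in> borel_measurable G"
    "\<And>w. w \<in> space G \<Longrightarrow> l w \<in> K"
    "\<And>w. w \<in> space G \<Longrightarrow> (\<lambda>m. v (\<tau> m w) w) \<longlonglongrightarrow> l w"
proof -
  have "\<exists>q (n::nat). K \<subseteq> (\<Union>l<n. ball (q l) ((1/2)^i))" for i :: nat
  proof -
    obtain k where k: "finite k" "K \<subseteq> (\<Union>x\<in>k. ball x ((1/2)^i))"
      using seq_compact_imp_totally_bounded[of K] K
      by (metis compact_imp_seq_compact half_gt_zero_iff zero_less_one zero_less_power)
    obtain q and n :: nat where "k = q ` {i. i < n}"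
      using finite_imp_nat_seg_image_inj_on[OF k(1)] by blast
    with k(2) show ?thesis
      by (intro exI[of _ q] exI[of _ n]) (auto simp: lessThan_def)
  qed
  then obtain q and n :: "nat \<Rightarrow> nat" where q: "\<And>i. K \<subseteq> (\<Union>l<n i. ball (q i l) ((1/2)^i))"
    by metis
  define R where "R = nested_ball q v"
  define a where "a i w = (LEAST l. \<exists>\<^sub>\<infinity>j. R i j w \<and> dist (q i l) (v j w) < (1/2)^i)" for i w
  have R_Suc: "R (Suc i) j w \<longleftrightarrow> R i j w \<and> dist (q i (a i w)) (v j w) < (1/2)^i" for i j w
    by (simp add: R_def a_def)
  have R_meas[measurable]: "Measurable.pred G (R i j)" for i j
  proof (induction i arbitrary: j)
    case 0
    show ?case by (simp add: R_def)
  next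
    case (Suc i)
    note Suc[measurable]
    have [measurable]: "a i \<in> G \<rightarrow>\<^sub>M count_space UNIV"
      unfolding a_def INFM_nat by measurable
    have [measurable]: "(\<lambda>w. q i (a i w)) \<in> borel_measurable G"
      by (rule measurable_compose[of "a i" G "count_space UNIV"]) auto
    show ?case
      unfolding R_Suc by measurable
  qed
  have io: "\<exists>\<^sub>\<infinity>j. R i j w" if w: "w \<in> space G" for i w
  proof (induction i)
    case 0
    show ?case by (simp add: R_def)
  next
    case (Suc i)
    have "\<exists>\<^sub>\<infinity>j. \<exists>l\<in>{..<n i}. R i j w \<and> dist (q i l) (v j w) < (1/2)^i"
      by (rule INFM_mono[OF Suc]) (use q[of i] vK[OF w] in fastforce)
    then have "\<exists>l. \<exists>\<^sub>\<infinity>j. R i j w \<and> dist (q i l) (v j w) < (1/2)^i"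
      by (subst (asm) frequently_bex_finite_distrib) auto
    from LeastI_ex[OF this] show ?case
      unfolding R_Suc a_def .
  qed
  obtain \<tau> where \<tau>[measurable]: "\<And>m. \<tau> m \<in> G \<rightarrow>\<^sub>M count_space UNIV"
    and mono: "\<And>w. w \<in> space G \<Longrightarrow> strict_mono (\<lambda>m. \<tau> m w)"
    and hit: "\<And>m w. w \<in> space G \<Longrightarrow> R m (\<tau> m w) w"
    using measurable_random_subsequence[where G=G and R=R, OF R_meas io] by blast
  have R_anti: "R i j w" if "R m j w" "i \<le> m" for i m j w
    using that(2,1) by (induction rule: dec_induct) (auto simp: R_Suc)
  have conv: "convergent (\<lambda>m. v (\<tau> m w) w)" if w: "w \<in> space G" for w
  proof -
    have "Cauchy (\<lambda>m. v (\<tau> m w) w)"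
    proof (rule metric_CauchyI)
      fix e :: real assume "0 < e"
      then obtain i where i: "(1/2)^i < e / 2"
        using real_arch_pow_inv[of "e/2" "1/2"] by auto
      have near: "dist (q i (a i w)) (v (\<tau> m w) w) < (1/2)^i" if "m \<ge> Suc i" for m
        using R_anti[OF hit[OF w] that] by (simp add: R_Suc)
      show "\<exists>M. \<forall>m\<ge>M. \<forall>n\<ge>M. dist (v (\<tau> m w) w) (v (\<tau> n w) w) < e"
      proof (intro exI allI impI)
        fix m n assume "m \<ge> Suc i" "n \<ge> Suc i"
        with near[of m] near[of n] i show "dist (v (\<tau> m w) w) (v (\<tau> n w) w) < e"
          using dist_triangle3[of "v (\<tau> m w) w" "v (\<tau> n w) w" "q i (a i w)"] by linarith
      qed
    qed
    then show ?thesis by (simp add: Cauchy_convergent_iff)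
  qed
  define l where "l w = lim (\<lambda>m. v (\<tau> m w) w)" for w
  have lim: "(\<lambda>m. v (\<tau> m w) w) \<longlonglongrightarrow> l w" if "w \<in> space G" for w
    using conv[OF that] by (simp add: convergent_LIMSEQ_iff l_def)
  show thesis
  proof (rule that[of \<tau> l])
    show "l \<in> borel_measurable G"
      unfolding l_def by (intro borel_measurable_lim_polish measurable_compose_countable[OF v \<tau>])
    show "l w \<in> K" if "w \<in> space G" for w
      using closed_sequentially[OF compact_imp_closed[OF K] _ lim[OF that]] vK[OF that] by auto
  qed (use mono lim in auto)
qed

text \<open>
  Split according to the value of \<open>\<tau>\<close>: the event \<open>\<tau> w = j\<close> belongs to \<open>G\<close>, so on it \<open>X j\<close> may be
  replaced by its conditional expectation.
\<close>

lemma nn_integral_nn_cond_exp_random_index: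
  fixes X :: "nat \<Rightarrow> 'w \<Rightarrow> ennreal"
  assumes "prob_space P" "subalgebra P G"
    and X[measurable]: "\<And>j. X j \<in> borel_measurable P"
    and \<tau>[measurable]: "\<tau> \<in> G \<rightarrow>\<^sub>M count_space UNIV"
  shows "(\<integral>\<^sup>+ w. X (\<tau> w) w \<partial>P) = (\<integral>\<^sup>+ w. nn_cond_exp P G (X (\<tau> w)) w \<partial>P)"
proof -
  interpret prob_space P by fact
  interpret finite_measure_subalgebra P G by standard fact
  have \<tau>P[measurable]: "\<tau> \<in> P \<rightarrow>\<^sub>M count_space UNIV"
    by (rule measurable_from_subalg[OF subalg \<tau>])
  have split: "(\<integral>\<^sup>+ w. F (\<tau> w) w \<partial>P) = (\<Sum>j. \<integral>\<^sup>+ w. of_bool (\<tau> w = j) * F j w \<partial>P)"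
    if [measurable]: "\<And>j. F j \<in> borel_measurable P" for F :: "nat \<Rightarrow> 'w \<Rightarrow> ennreal"
  proof -
    have "F (\<tau> w) w = (\<Sum>j. of_bool (\<tau> w = j) * F j w)" for w
      by (subst suminf_finite[of "{\<tau> w}"]) auto
    then show ?thesis
      by (simp add: nn_integral_suminf)
  qed
  have "(\<integral>\<^sup>+ w. of_bool (\<tau> w = j) * nn_cond_exp P G (X j) w \<partial>P)
      = (\<integral>\<^sup>+ w. of_bool (\<tau> w = j) * X j w \<partial>P)" for j
    by (rule nn_cond_exp_intg) measurable
  then show ?thesis
    using split[of X] split[of "\<lambda>j. nn_cond_exp P G (X j)"] by simp
qed

text \<open>
  Passing to a random subsequence so that the actions \<open>v\<close> converge without increasing the limit
  inferior of the expected costs. With \<open>Z j\<close> the conditional expectation of \<open>X j\<close> and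
  \<open>L = liminf Z\<close>, the index \<open>\<tau> m\<close> is chosen so that \<open>Z (\<tau> m) \<le> L + 1/(m+1)\<close>; then
  \<open>E (X (\<tau> m)) \<le> E L + 1/(m+1)\<close>, and \<open>E L \<le> liminf (E Z) = liminf (E X)\<close> by Fatou's lemma. The bound
  survives the further refinement that makes \<open>v\<close> converge. Where \<open>L\<close> is infinite, every index
  satisfies the constraint.
\<close>

lemma conditional_subsequence:
  fixes v :: "nat \<Rightarrow> 'w \<Rightarrow> 'u::polish_space" and X :: "nat \<Rightarrow> 'w \<Rightarrow> ennreal"
  assumes P: "prob_space P" and G: "subalgebra P G"
    and X[measurable]: "\<And>j. X j \<in> borel_measurable P"
    and K: "compact K"
    and v[measurable]: "\<And>j. v j \<in> borel_measurable G"
    and vK: "\<And>j w. w \<in> space G \<Longrightarrow> v j w \<in> K"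
  obtains \<tau> :: "nat \<Rightarrow> 'w \<Rightarrow> nat" and l where
    "\<And>m. \<tau> m \<in> G \<rightarrow>\<^sub>M count_space UNIV"
    "\<And>w. w \<in> space G \<Longrightarrow> strict_mono (\<lambda>m. \<tau> m w)"
    "l \<in> borel_measurable G"
    "\<And>w. w \<in> space G \<Longrightarrow> l w \<in> K"
    "\<And>w. w \<in> space G \<Longrightarrow> (\<lambda>m. v (\<tau> m w) w) \<longlonglongrightarrow> l w"
    "liminf (\<lambda>m. \<integral>\<^sup>+ w. X (\<tau> m w) w \<partial>P) \<le> liminf (\<lambda>m. \<integral>\<^sup>+ w. X m w \<partial>P)"
proof -
  interpret prob_space P by fact
  interpret finite_measure_subalgebra P G by standard fact
  define Z where "Z j = nn_cond_exp P G (X j)" for j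
  have Z[measurable]: "Z j \<in> borel_measurable G" for j
    by (simp add: Z_def)
  define L where "L w = liminf (\<lambda>j. Z j w)" for w
  have L[measurable]: "L \<in> borel_measurable G"
    unfolding L_def by measurable
  define R where "R m j w \<longleftrightarrow> Z j w \<le> L w + ennreal (1 / Suc m)" for m j w
  have R_meas: "Measurable.pred G (R m j)" for m j
    unfolding R_def by measurable
  have io: "\<exists>\<^sub>\<infinity>j. R m j w" for m w
  proof (rule ccontr)
    assume "\<not> ?thesis"
    then have ev: "\<forall>\<^sub>F j in sequentially. L w + ennreal (1 / Suc m) < Z j w"
      by (simp add: R_def not_frequently not_le cofinite_eq_sequentially)
    then have "L w + ennreal (1 / Suc m) \<le> L w"
      unfolding L_def[of w] by (intro Liminf_bounded) (auto elim: eventually_mono)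
    moreover have "L w \<noteq> top"
      using ev by (auto simp: eventually_sequentially)
    ultimately show False
      using ennreal_add_left_cancel_le[of "L w" "ennreal (1 / Suc m)" 0] by (simp add: ennreal_eq_0_iff)
  qed
  obtain \<rho> where \<rho>[measurable]: "\<And>m. \<rho> m \<in> G \<rightarrow>\<^sub>M count_space UNIV"
    and \<rho>_mono: "\<And>w. w \<in> space G \<Longrightarrow> strict_mono (\<lambda>m. \<rho> m w)"
    and \<rho>R: "\<And>m w. w \<in> space G \<Longrightarrow> R m (\<rho> m w) w"
    using measurable_random_subsequence[where G=G and R=R, OF R_meas io] by blast
  obtain \<theta> l where \<theta>[measurable]: "\<And>m. \<theta> m \<in> G \<rightarrow>\<^sub>M count_space UNIV"
    and \<theta>_mono: "\<And>w. w \<in> space G \<Longrightarrow> strict_mono (\<lambda>m. \<theta> m w)"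
    and l: "l \<in> borel_measurable G" "\<And>w. w \<in> space G \<Longrightarrow> l w \<in> K"
      "\<And>w. w \<in> space G \<Longrightarrow> (\<lambda>m. v (\<rho> (\<theta> m w) w) w) \<longlonglongrightarrow> l w"
    by (rule measurable_bolzano_weierstrass[where v="\<lambda>j w. v (\<rho> j w) w" and G=G,
          OF K measurable_compose_countable[OF v \<rho>] vK])
      (assumption, rule that, assumption+)
  define \<tau> where "\<tau> m w = \<rho> (\<theta> m w) w" for m w
  have \<tau>[measurable]: "\<tau> m \<in> G \<rightarrow>\<^sub>M count_space UNIV" for m
    unfolding \<tau>_def by (rule measurable_compose_countable[OF \<rho> \<theta>])
  have space: "space G = space P"
    using G by (simp add: subalgebra_def)
  have bound: "(\<integral>\<^sup>+ w. X (\<tau> m w) w \<partial>P) \<le> liminf (\<lambda>m. \<integral>\<^sup>+ w. X m w \<partial>P) + ennreal (1 / Suc m)" for m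
  proof -
    have "(\<integral>\<^sup>+ w. X (\<tau> m w) w \<partial>P) = (\<integral>\<^sup>+ w. Z (\<tau> m w) w \<partial>P)"
      unfolding Z_def by (rule nn_integral_nn_cond_exp_random_index[OF P G X \<tau>])
    also have "\<dots> \<le> (\<integral>\<^sup>+ w. L w + ennreal (1 / Suc m) \<partial>P)"
    proof (rule nn_integral_mono)
      fix w assume "w \<in> space P"
      then have w: "w \<in> space G" by (simp add: space)
      have "Z (\<tau> m w) w \<le> L w + ennreal (1 / Suc (\<theta> m w))"
        using \<rho>R[OF w] by (simp add: \<tau>_def R_def)
      also have "\<dots> \<le> L w + ennreal (1 / Suc m)"
        using strict_mono_imp_increasing[OF \<theta>_mono[OF w], of m]
        by (intro add_left_mono ennreal_leI frac_le) auto
      finally show "Z (\<tau> m w) w \<le> L w + ennreal (1 / Suc m)" .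
    qed
    also have "\<dots> = (\<integral>\<^sup>+ w. L w \<partial>P) + ennreal (1 / Suc m)"
      by (subst nn_integral_add) (auto simp: emeasure_space_1 intro: measurable_from_subalg[OF subalg])
    also have "(\<integral>\<^sup>+ w. L w \<partial>P) \<le> liminf (\<lambda>m. \<integral>\<^sup>+ w. Z m w \<partial>P)"
      unfolding L_def by (intro nn_integral_liminf measurable_from_subalg[OF subalg Z])
    also have "(\<lambda>m. \<integral>\<^sup>+ w. Z m w \<partial>P) = (\<lambda>m. \<integral>\<^sup>+ w. X m w \<partial>P)"
      unfolding Z_def using nn_cond_exp_intg[of "\<lambda>_. 1"] by simp
    finally show ?thesis by (auto simp: add_right_mono)
  qed
  show thesis
  proof (rule that[of \<tau> l])
    show "strict_mono (\<lambda>m. \<tau> m w)" if "w \<in> space G" for w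
      using strict_mono_o[OF \<rho>_mono[OF that] \<theta>_mono[OF that]] by (simp add: \<tau>_def o_def)
    have "(\<lambda>m. liminf (\<lambda>m. \<integral>\<^sup>+ w. X m w \<partial>P) + ennreal (1 / Suc m))
        \<longlonglongrightarrow> liminf (\<lambda>m. \<integral>\<^sup>+ w. X m w \<partial>P) + ennreal 0"
      by (intro tendsto_add tendsto_const tendsto_ennrealI) (rule LIMSEQ_Suc[OF lim_1_over_n])
    then have "liminf (\<lambda>k. liminf (\<lambda>m. \<integral>\<^sup>+ w. X m w \<partial>P) + ennreal (1 / Suc k))
        = liminf (\<lambda>m. \<integral>\<^sup>+ w. X m w \<partial>P)"
      by (intro lim_imp_Liminf) auto
    moreover have "liminf (\<lambda>k. \<integral>\<^sup>+ w. X (\<tau> k w) w \<partial>P)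
        \<le> liminf (\<lambda>k. liminf (\<lambda>m. \<integral>\<^sup>+ w. X m w \<partial>P) + ennreal (1 / Suc k))"
      by (intro Liminf_mono always_eventually allI bound)
    ultimately show "liminf (\<lambda>m. \<integral>\<^sup>+ w. X (\<tau> m w) w \<partial>P) \<le> liminf (\<lambda>m. \<integral>\<^sup>+ w. X m w \<partial>P)"
      by (simp only:)
    show "(\<lambda>m. v (\<tau> m w) w) \<longlonglongrightarrow> l w" if "w \<in> space G" for w
      unfolding \<tau>_def by (rule l(3)[OF that])
  qed (fact l(1) l(2) \<tau>)+
qed

text \<open>
  Induction on the decision makers. At stage \<open>n\<close> the random indices are measurable with respect to
  \<open>G k\<close> for all \<open>k \<ge> n\<close>, hence the relabelled actions of decision maker \<open>n + 1\<close> are still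
  \<open>G (n + 1)\<close>-measurable and \<open>conditional_subsequence\<close> applies to them; the limits already obtained
  are not affected by refining the subsequence. The relabelled sequence need not consist of admissible
  policies (the action of an early decision maker may depend on later information), but the limits do.
\<close>

lemma adapted_subsequence:
  fixes v :: "nat \<Rightarrow> nat \<Rightarrow> 'w \<Rightarrow> 'u::polish_space" and X :: "nat \<Rightarrow> 'w \<Rightarrow> ennreal"
  assumes P: "prob_space P"
    and G: "\<And>k. k \<in> {1..N} \<Longrightarrow> subalgebra P (G k)"
    and G_mono: "\<And>k. k \<in> {1..<N} \<Longrightarrow> sets (G k) \<subseteq> sets (G (Suc k))"
    and X[measurable]: "\<And>j. X j \<in> borel_measurable P"
    and K: "\<And>k. k \<in> {1..N} \<Longrightarrow> compact (K k)"
    and v: "\<And>j k. k \<in> {1..N} \<Longrightarrow> v j k \<in> borel_measurable (G k)"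
    and vK: "\<And>j k w. k \<in> {1..N} \<Longrightarrow> w \<in> space P \<Longrightarrow> v j k w \<in> K k"
  obtains \<sigma> :: "nat \<Rightarrow> 'w \<Rightarrow> nat" and l where
    "\<And>m. \<sigma> m \<in> P \<rightarrow>\<^sub>M count_space UNIV"
    "\<And>k. k \<in> {1..N} \<Longrightarrow> l k \<in> borel_measurable (G k)"
    "\<And>k w. k \<in> {1..N} \<Longrightarrow> w \<in> space P \<Longrightarrow> l k w \<in> K k"
    "\<And>k w. k \<in> {1..N} \<Longrightarrow> w \<in> space P \<Longrightarrow> (\<lambda>m. v (\<sigma> m w) k w) \<longlonglongrightarrow> l k w"
    "liminf (\<lambda>m. \<integral>\<^sup>+ w. X (\<sigma> m w) w \<partial>P) \<le> liminf (\<lambda>m. \<integral>\<^sup>+ w. X m w \<partial>P)"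
proof -
  have space: "space (G k) = space P" if "k \<in> {1..N}" for k
    using G[OF that] by (simp add: subalgebra_def)
  have "\<exists>(\<sigma> :: nat \<Rightarrow> 'w \<Rightarrow> nat) l.
      (\<forall>m. \<sigma> m \<in> P \<rightarrow>\<^sub>M count_space UNIV) \<and>
      (\<forall>k\<in>{1..N}. n \<le> k \<longrightarrow> (\<forall>m. \<sigma> m \<in> G k \<rightarrow>\<^sub>M count_space UNIV)) \<and>
      (\<forall>k\<in>{1..n}. l k \<in> borel_measurable (G k) \<and>
         (\<forall>w\<in>space P. l k w \<in> K k \<and> (\<lambda>m. v (\<sigma> m w) k w) \<longlonglongrightarrow> l k w)) \<and>
      liminf (\<lambda>m. \<integral>\<^sup>+ w. X (\<sigma> m w) w \<partial>P) \<le> liminf (\<lambda>m. \<integral>\<^sup>+ w. X m w \<partial>P)" (is "\<exists>\<sigma> l. ?Q n \<sigma> l")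
    if "n \<le> N" for n
    using that
  proof (induction n)
    case 0
    show ?case
      by (rule exI[of _ "\<lambda>m w. m"], rule exI) simp
  next
    case (Suc n)
    let ?G = "G (Suc n)"
    from Suc.prems have n: "Suc n \<in> {1..N}" by simp
    obtain \<sigma> l where Q: "?Q n \<sigma> l"
      using Suc.IH[OF Suc_leD[OF Suc.prems]] by (elim exE)
    have \<sigma>P[measurable]: "\<sigma> m \<in> P \<rightarrow>\<^sub>M count_space UNIV" for m
      using Q by simp
    have l: "l k \<in> borel_measurable (G k)" "w \<in> space P \<Longrightarrow> l k w \<in> K k"
        "w \<in> space P \<Longrightarrow> (\<lambda>m. v (\<sigma> m w) k w) \<longlonglongrightarrow> l k w" if "k \<in> {1..n}" for k w
      using Q that by simp_all
    have E: "liminf (\<lambda>m. \<integral>\<^sup>+ w. X (\<sigma> m w) w \<partial>P) \<le> liminf (\<lambda>m. \<integral>\<^sup>+ w. X m w \<partial>P)"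
      using Q by simp
    have \<sigma>G[measurable]: "\<sigma> m \<in> ?G \<rightarrow>\<^sub>M count_space UNIV" for m
      using Q n by simp
    obtain \<tau> l' where \<tau>[measurable]: "\<And>m. \<tau> m \<in> ?G \<rightarrow>\<^sub>M count_space UNIV"
      and \<tau>_mono: "\<And>w. w \<in> space ?G \<Longrightarrow> strict_mono (\<lambda>m. \<tau> m w)"
      and l': "l' \<in> borel_measurable ?G"
        "\<And>w. w \<in> space ?G \<Longrightarrow> l' w \<in> K (Suc n)"
        "\<And>w. w \<in> space ?G \<Longrightarrow> (\<lambda>m. v (\<sigma> (\<tau> m w) w) (Suc n) w) \<longlonglongrightarrow> l' w"
      and E': "liminf (\<lambda>m. \<integral>\<^sup>+ w. X (\<sigma> (\<tau> m w) w) w \<partial>P) \<le> liminf (\<lambda>m. \<integral>\<^sup>+ w. X (\<sigma> m w) w \<partial>P)"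
    proof (rule conditional_subsequence[OF P G[OF n], of "\<lambda>j w. X (\<sigma> j w) w" "K (Suc n)"
          "\<lambda>j w. v (\<sigma> j w) (Suc n) w"])
      show "(\<lambda>w. X (\<sigma> j w) w) \<in> borel_measurable P" for j
        by (rule measurable_compose_countable[OF X \<sigma>P])
      show "(\<lambda>w. v (\<sigma> j w) (Suc n) w) \<in> borel_measurable ?G" for j
        by (rule measurable_compose_countable[OF v[OF n] \<sigma>G])
    qed (use K[OF n] vK[OF n] space[OF n] in auto)
    define \<sigma>' where "\<sigma>' m w = \<sigma> (\<tau> m w) w" for m w
    have \<sigma>'G: "\<sigma>' m \<in> ?G \<rightarrow>\<^sub>M count_space UNIV" for m
      unfolding \<sigma>'_def by (rule measurable_compose_countable[OF \<sigma>G \<tau>])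
    have "\<sigma>' m \<in> P \<rightarrow>\<^sub>M count_space UNIV" for m
      by (rule measurable_from_subalg[OF G[OF n] \<sigma>'G])
    moreover have "\<sigma>' m \<in> G k \<rightarrow>\<^sub>M count_space UNIV" if "k \<in> {1..N}" "Suc n \<le> k" for k m
    proof -
      have "sets ?G \<subseteq> sets (G k)"
        using that(2,1)
      proof (induction rule: dec_induct)
        case (step i)
        then show ?case using G_mono[of i] by fastforce
      qed simp
      then have "subalgebra (G k) ?G"
        using space[OF n] space[OF that(1)] by (simp add: subalgebra_def)
      then show ?thesis
        using \<sigma>'G by (rule measurable_from_subalg)
    qed
    moreover have "(\<lambda>m. v (\<sigma>' m w) k w) \<longlonglongrightarrow> l k w" if "k \<in> {1..n}" "w \<in> space P" for k w
      using LIMSEQ_subseq_LIMSEQ[OF l(3)[OF that] \<tau>_mono[of w]] that space[OF n]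
      by (simp add: \<sigma>'_def o_def)
    moreover have "liminf (\<lambda>m. \<integral>\<^sup>+ w. X (\<sigma>' m w) w \<partial>P) \<le> liminf (\<lambda>m. \<integral>\<^sup>+ w. X m w \<partial>P)"
      using E E' by (simp add: \<sigma>'_def)
    moreover have "(\<lambda>m. v (\<sigma>' m w) (Suc n) w) \<longlonglongrightarrow> l' w" if "w \<in> space P" for w
      using l'(3) that space[OF n] by (simp add: \<sigma>'_def)
    ultimately have "?Q (Suc n) \<sigma>' (l(Suc n := l'))"
      using l(1,2) l'(1,2) unfolding space[OF n] by (auto simp: le_Suc_eq)
    then show ?case by (intro exI)
  qed
  from this[OF order_refl] obtain \<sigma> l where "?Q N \<sigma> l"
    by (elim exE)
  then show thesis
    by (intro that[of \<sigma> l]) simp_all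
qed

section \<open>Realising a stochastic kernel by a uniform random seed\<close>

text \<open>
  The enumeration of the Cantor set by ternary digits 0 and 2. Since the possible first digits give values
  in \<open>[0, 1/3]\<close> and \<open>[2/3, 1]\<close>, comparison with \<open>1/2\<close> reads off the first bit, and \<open>cantor_expand\<close>
  removes it.
\<close>

definition cantor_code :: "(nat \<Rightarrow> bool) \<Rightarrow> real" where
  "cantor_code b = (\<Sum>i. 2 * of_bool (b i) / 3 ^ Suc i)"

definition cantor_expand :: "real \<Rightarrow> real" where
  "cantor_expand x = 3 * x - (if 1/2 \<le> x then 2 else 0)"

lemma summable_cantor_code: "summable (\<lambda>i. 2 * of_bool (b i) / 3 ^ Suc i :: real)"
proof (rule summable_comparison_test')
  show "summable (\<lambda>i. 2/3 * (1/3) ^ i :: real)"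
    by (intro summable_mult summable_geometric) simp
qed (auto simp: power_divide)

lemma cantor_code_bounds: "0 \<le> cantor_code b" "cantor_code b \<le> 1"
proof -
  show "0 \<le> cantor_code b"
    unfolding cantor_code_def by (intro suminf_nonneg summable_cantor_code) simp
  have "cantor_code b \<le> (\<Sum>i. 2/3 * (1/3) ^ i)"
    unfolding cantor_code_def
    by (intro suminf_le summable_cantor_code summable_mult summable_geometric) (auto simp: power_divide)
  also have "\<dots> = 1"
    by (subst suminf_mult) (simp_all add: suminf_geometric)
  finally show "cantor_code b \<le> 1" .
qed

lemma cantor_code_Suc: "cantor_code b = (2 * of_bool (b 0) + cantor_code (\<lambda>n. b (Suc n))) / 3"
proof -
  have "cantor_code b - 2 * of_bool (b 0) / 3 = (\<Sum>i. 2 * of_bool (b (Suc i)) / 3 ^ Suc (Suc i))"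
    using suminf_minus_initial_segment[OF summable_cantor_code[of b], of 1]
    by (simp add: cantor_code_def)
  also have "\<dots> = (\<Sum>i. 2 * of_bool (b (Suc i)) / 3 ^ Suc i / 3)"
    by (simp add: field_simps)
  also have "\<dots> = cantor_code (\<lambda>n. b (Suc n)) / 3"
    unfolding cantor_code_def by (rule suminf_divide[OF summable_cantor_code])
  finally show ?thesis
    by (simp add: field_simps)
qed

lemma half_le_cantor_code_iff: "1/2 \<le> cantor_code b \<longleftrightarrow> b 0"
  using cantor_code_bounds[of "\<lambda>n. b (Suc n)"] by (subst cantor_code_Suc) auto

lemma cantor_expand_code: "cantor_expand (cantor_code b) = cantor_code (\<lambda>n. b (Suc n))"
  unfolding cantor_expand_def half_le_cantor_code_iff
  by (subst cantor_code_Suc) (auto simp: field_simps)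

lemma cantor_decode: "1/2 \<le> (cantor_expand ^^ n) (cantor_code b) \<longleftrightarrow> b n"
proof -
  have "(cantor_expand ^^ n) (cantor_code b) = cantor_code (\<lambda>i. b (i + n))"
    by (induction n) (simp_all add: cantor_expand_code)
  then show ?thesis
    by (simp only: half_le_cantor_code_iff add_0)
qed

text \<open>
  Combining the two codes. The Borel left inverse \<open>d\<close> is defined on all reals, so random reals can be
  decoded without knowing that they are codes.
\<close>

lemma polish_real_code:
  obtains e :: "'b::polish_space \<Rightarrow> real" and d :: "real \<Rightarrow> 'b"
  where "e \<in> borel_measurable borel" "d \<in> borel_measurable borel" "\<And>u. d (e u) = u"
proof -
  obtain B :: "nat \<Rightarrow> 'b set" and d where B: "\<And>n. open (B n)" "\<And>u. d (\<lambda>n. u \<in> B n) = u"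
    and d: "d \<in> borel_measurable (\<Pi>\<^sub>M n\<in>UNIV. count_space UNIV)"
    by (rule polish_bit_code) (rule that, assumption+)
  have [measurable]: "B n \<in> sets borel" for n
    using B(1) by simp
  have expand[measurable]: "(cantor_expand ^^ n) \<in> borel_measurable borel" for n
  proof (induction n)
    case (Suc n)
    note Suc[measurable]
    show ?case
      by (simp add: o_def cantor_expand_def) measurable
  qed simp
  show thesis
  proof (rule that)
    show "(\<lambda>u. cantor_code (\<lambda>n. u \<in> B n)) \<in> borel_measurable borel"
      unfolding cantor_code_def by measurable
    show "(\<lambda>x. d (\<lambda>n. 1/2 \<le> (cantor_expand ^^ n) x)) \<in> borel_measurable borel"
      by (intro measurable_compose[OF _ d] measurable_PiM_single') (auto simp: PiE_UNIV_domain)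
    show "d (\<lambda>n. 1/2 \<le> (cantor_expand ^^ n) (cantor_code (\<lambda>n. u \<in> B n))) = u" for u
      by (simp only: cantor_decode B(2))
  qed
qed

abbreviation unit_uniform :: "real measure" where
  "unit_uniform \<equiv> restrict_space lborel {0<..<1}"

lemma prob_space_unit_uniform: "prob_space unit_uniform"
  by (auto simp: emeasure_restrict_space space_restrict_space intro!: prob_spaceI)

text \<open>
  The kernel is moved to the real line by \<open>polish_real_code\<close>, giving laws \<open>K y\<close>. The quantile
  \<open>q y t\<close> of \<open>K y\<close> at a uniform \<open>t\<close> has law \<open>K y\<close>, and it is jointly measurable because
  \<open>q y t \<le> a\<close> means \<open>t \<le> cdf (K y) a\<close>. Decoding the quantiles gives \<open>\<phi>\<close>.
\<close>

lemma kernel_randomization: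
  fixes U :: "'u::polish_space set"
  assumes U: "U \<in> sets borel" "U \<noteq> {}" and \<pi>: "\<pi> \<in> M \<rightarrow>\<^sub>M prob_algebra (borel_on U)"
  obtains \<phi> where "(\<lambda>(y, t). \<phi> y t) \<in> M \<Otimes>\<^sub>M unit_uniform \<rightarrow>\<^sub>M borel_on U"
    "\<And>y. y \<in> space M \<Longrightarrow> distr unit_uniform (borel_on U) (\<phi> y) = \<pi> y"
proof -
  obtain e :: "'u \<Rightarrow> real" and d where e[measurable]: "e \<in> borel_measurable borel"
    and d[measurable]: "d \<in> borel_measurable borel" and de: "\<And>u. d (e u) = u"
    by (rule polish_real_code) (rule that, assumption+)
  obtain u0 where u0: "u0 \<in> U" using U(2) by blast
  \<comment> \<open>decoding, corrected to take values in \<open>U\<close> also at reals that are not codes of points of \<open>U\<close>\<close>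
  define \<psi> where "\<psi> x = (if d x \<in> U then d x else u0)" for x
  note U(1)[measurable]
  have \<psi>[measurable]: "\<psi> \<in> borel \<rightarrow>\<^sub>M borel_on U"
    unfolding \<psi>_def by (rule measurable_restrict_space2) (use u0 in auto)
  have e'[measurable]: "e \<in> borel_measurable (borel_on U)"
    by (rule measurable_restrict_space1[OF e])
  define K where "K y = distr (\<pi> y) borel e" for y
  define q where "q y t = Inf {x. t \<le> cdf (K y) x}" for y t
  have sets_\<pi>: "sets (\<pi> y) = sets (borel_on U)" and prob_\<pi>: "prob_space (\<pi> y)" if "y \<in> space M" for y
    using measurable_space[OF \<pi> that] by (auto simp: space_prob_algebra)
  have e_\<pi>: "e \<in> borel_measurable (\<pi> y)" if "y \<in> space M" for y
    unfolding measurable_cong_sets[OF sets_\<pi>[OF that] refl] by (rule e')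
  have K: "cdf_distribution (K y)" if y: "y \<in> space M" for y
  proof -
    interpret prob_space "K y"
      unfolding K_def by (rule prob_space.prob_space_distr[OF prob_\<pi>[OF y] e_\<pi>[OF y]])
    show ?thesis
      by unfold_locales (simp_all add: K_def)
  qed
  have K_meas: "K \<in> M \<rightarrow>\<^sub>M prob_algebra borel"
    unfolding K_def by (rule measurable_distr_prob_space2[OF \<pi>]) measurable
  have cdf_meas[measurable]: "(\<lambda>y. cdf (K y) a) \<in> borel_measurable M" for a
    unfolding cdf_def by (rule measurable_compose[OF K_meas measurable_measure_prob_algebra]) simp
  have q_meas: "(\<lambda>(y, t). q y t) \<in> borel_measurable (M \<Otimes>\<^sub>M unit_uniform)"
  proof (rule borel_measurableI_le)
    fix a
    have [measurable]: "(\<lambda>t. t) \<in> borel_measurable unit_uniform"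
      by (rule measurable_restrict_space1) simp
    have "{z \<in> space (M \<Otimes>\<^sub>M unit_uniform). (case z of (y, t) \<Rightarrow> q y t) \<le> a}
        = {z \<in> space (M \<Otimes>\<^sub>M unit_uniform). snd z \<le> cdf (K (fst z)) a}"
    proof (safe; clarsimp simp: space_pair_measure space_restrict_space)
      fix y t assume y: "y \<in> space M" and t: "0 < t" "t < (1::real)"
      interpret cdf_distribution "K y" by (rule K[OF y])
      show "t \<le> cdf (K y) a" if "q y t \<le> a"
        using pseudoinverse[OF t, of a] that by (simp add: q_def)
      show "q y t \<le> a" if "t \<le> cdf (K y) a"
        using pseudoinverse[OF t, of a] that by (simp add: q_def)
    qed
    also have "\<dots> \<in> sets (M \<Otimes>\<^sub>M unit_uniform)"
      by measurable
    finally show "{z \<in> space (M \<Otimes>\<^sub>M unit_uniform). (case z of (y, t) \<Rightarrow> q y t) \<le> a}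
        \<in> sets (M \<Otimes>\<^sub>M unit_uniform)" .
  qed
  show thesis
  proof (rule that)
    show "(\<lambda>(y, t). \<psi> (q y t)) \<in> M \<Otimes>\<^sub>M unit_uniform \<rightarrow>\<^sub>M borel_on U"
      using measurable_compose[OF q_meas \<psi>] by (simp add: case_prod_beta')
    fix y assume y: "y \<in> space M"
    interpret cdf_distribution "K y" by (rule K[OF y])
    have q_y[measurable]: "q y \<in> borel_measurable unit_uniform"
      using measurable_CI by (simp add: q_def[abs_def] cong: measurable_cong_sets)
    have "distr unit_uniform (borel_on U) (\<lambda>t. \<psi> (q y t))
        = distr (distr unit_uniform borel (q y)) (borel_on U) \<psi>"
      by (subst distr_distr) (auto simp: o_def)
    also have "distr unit_uniform borel (q y) = K y"
      using distr_I_eq_M by (simp add: q_def[abs_def])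
    also have "distr (K y) (borel_on U) \<psi> = distr (\<pi> y) (borel_on U) (\<lambda>u. \<psi> (e u))"
      unfolding K_def using e_\<pi>[OF y] by (subst distr_distr) (auto simp: o_def)
    also have "\<dots> = distr (\<pi> y) (\<pi> y) (\<lambda>u. u)"
      using sets_\<pi>[OF y] sets_eq_imp_space_eq[OF sets_\<pi>[OF y]]
      by (intro distr_cong) (auto simp: \<psi>_def de space_restrict_space)
    also have "\<dots> = \<pi> y"
      by (rule distr_id)
    finally show "distr unit_uniform (borel_on U) (\<lambda>t. \<psi> (q y t)) = \<pi> y" .
  qed
qed

lemma PiM_distr_components:
  assumes I: "finite I" and M: "\<And>i. i \<in> I \<Longrightarrow> prob_space (M i)"
    and f: "\<And>i. i \<in> I \<Longrightarrow> f i \<in> M i \<rightarrow>\<^sub>M N i"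
  shows "(\<Pi>\<^sub>M i\<in>I. distr (M i) (N i) (f i))
      = distr (\<Pi>\<^sub>M i\<in>I. M i) (\<Pi>\<^sub>M i\<in>I. N i) (\<lambda>x. \<lambda>i\<in>I. f i (x i))"
proof -
  \<comment> \<open>\<open>product_prob_space\<close> asks for a probability measure at every index, also outside \<open>I\<close>\<close>
  define M' where "M' i = (if i \<in> I then M i else return (count_space UNIV) undefined)" for i
  define D where "D i = (if i \<in> I then distr (M i) (N i) (f i) else return (count_space UNIV) undefined)" for i
  interpret M': product_prob_space M'
    by (rule product_prob_spaceI) (auto simp: M'_def M intro!: prob_space_return)
  interpret D: product_prob_space D
    by (rule product_prob_spaceI)
      (auto simp: D_def intro!: prob_space_return prob_space.prob_space_distr M f)
  have M'_eq: "PiM I M' = PiM I M"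
    by (rule PiM_cong) (simp_all add: M'_def)
  have f_meas[measurable]: "(\<lambda>x. \<lambda>i\<in>I. f i (x i)) \<in> PiM I M \<rightarrow>\<^sub>M PiM I N"
    by (intro measurable_restrict measurable_compose[OF _ f]) auto
  have "distr (PiM I M) (PiM I N) (\<lambda>x. \<lambda>i\<in>I. f i (x i)) = PiM I D"
  proof (rule D.PiM_eqI[OF I])
    show "sets (distr (PiM I M) (PiM I N) (\<lambda>x. \<lambda>i\<in>I. f i (x i))) = sets (PiM I D)"
      by (simp, rule sets_PiM_cong) (simp_all add: D_def)
    fix A assume A: "\<And>i. i \<in> I \<Longrightarrow> A i \<in> sets (D i)"
    then have A': "A i \<in> sets (N i)" if "i \<in> I" for i
      using A[OF that] that by (simp add: D_def)
    have "(\<lambda>x. \<lambda>i\<in>I. f i (x i)) -` Pi\<^sub>E I A \<inter> space (PiM I M)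
        = (\<Pi>\<^sub>E i\<in>I. f i -` A i \<inter> space (M i))"
      by (auto simp: space_PiM PiE_iff)
    then have "emeasure (distr (PiM I M) (PiM I N) (\<lambda>x. \<lambda>i\<in>I. f i (x i))) (Pi\<^sub>E I A)
        = emeasure (PiM I M') (\<Pi>\<^sub>E i\<in>I. f i -` A i \<inter> space (M i))"
      using I A' by (simp add: emeasure_distr sets_PiM_I_finite M'_eq)
    also have "\<dots> = (\<Prod>i\<in>I. emeasure (M' i) (f i -` A i \<inter> space (M i)))"
      using f A' by (intro M'.emeasure_PiM I) (auto simp: M'_def intro: measurable_sets)
    also have "\<dots> = (\<Prod>i\<in>I. emeasure (D i) (A i))"
      using f A' by (intro prod.cong refl) (simp add: M'_def D_def emeasure_distr)
    finally show "emeasure (distr (PiM I M) (PiM I N) (\<lambda>x. \<lambda>i\<in>I. f i (x i))) (Pi\<^sub>E I A)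
        = (\<Prod>i\<in>I. emeasure (D i) (A i))" .
  qed
  moreover have "PiM I D = (\<Pi>\<^sub>M i\<in>I. distr (M i) (N i) (f i))"
    by (rule PiM_cong) (simp_all add: D_def)
  ultimately show ?thesis by simp
qed

text \<open>
  Realise the kernel of each decision maker with its own uniform seed. For a fixed seed vector \<open>s\<close> the
  actions form a deterministic policy \<open>\<gamma> s\<close>, and by Fubini's theorem the cost of the randomised policy
  is the average over \<open>s\<close> of the costs of \<open>\<gamma> s\<close>.
\<close>

lemma cost_rand_ge_INF_cost_det:
  fixes U :: "nat \<Rightarrow> 'u::polish_space set" and Y :: "nat \<Rightarrow> 'y::polish_space set"
  assumes P: "prob_space P"
    and U: "\<And>k. k \<in> {1..N} \<Longrightarrow> U k \<in> sets borel" "\<And>k. k \<in> {1..N} \<Longrightarrow> U k \<noteq> {}"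
    and \<omega>0[measurable]: "\<omega>0 \<in> P \<rightarrow>\<^sub>M borel_on \<Omega>0"
    and y: "\<And>k. k \<in> {1..N} \<Longrightarrow> y k \<in> P \<rightarrow>\<^sub>M borel_on (Y k)"
    and c: "(\<lambda>(x, us). c x us) \<in> borel_measurable (borel_on \<Omega>0 \<Otimes>\<^sub>M borel_prod N U)"
    and \<pi>: "randomized_policy N Y U \<pi>"
  shows "(INF \<gamma>\<in>{\<gamma>. deterministic_policy N Y U \<gamma>}. cost_det N P \<omega>0 y c \<gamma>)
      \<le> cost_rand N P \<omega>0 y c \<pi>"
proof -
  interpret P: prob_space P by fact
  let ?\<Lambda> = "\<Pi>\<^sub>M k\<in>{1..N}. unit_uniform"
  interpret \<Lambda>: prob_space ?\<Lambda>
    by (intro prob_space_PiM prob_space_unit_uniform)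
  interpret pair_sigma_finite P ?\<Lambda> ..
  have "\<exists>\<phi>. (\<lambda>(y, t). \<phi> y t) \<in> borel_on (Y k) \<Otimes>\<^sub>M unit_uniform \<rightarrow>\<^sub>M borel_on (U k) \<and>
      (\<forall>y\<in>space (borel_on (Y k)). distr unit_uniform (borel_on (U k)) (\<phi> y) = \<pi> k y)"
    if k: "k \<in> {1..N}" for k
    using kernel_randomization[OF U(1,2)[OF k]] \<pi> k unfolding randomized_policy_def by metis
  then obtain \<phi> where
    \<phi>: "\<And>k. k \<in> {1..N} \<Longrightarrow> (\<lambda>(y, t). \<phi> k y t) \<in> borel_on (Y k) \<Otimes>\<^sub>M unit_uniform \<rightarrow>\<^sub>M borel_on (U k)"
    and \<phi>_law: "\<And>k y. k \<in> {1..N} \<Longrightarrow> y \<in> space (borel_on (Y k)) \<Longrightarrow>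
        distr unit_uniform (borel_on (U k)) (\<phi> k y) = \<pi> k y"
    by metis
  have \<phi>_section: "\<phi> k z \<in> unit_uniform \<rightarrow>\<^sub>M borel_on (U k)" if "k \<in> {1..N}" "z \<in> space (borel_on (Y k))" for k z
    using measurable_Pair2[OF \<phi>[OF that(1)] that(2)] by simp
  define \<gamma> where "\<gamma> s k z = \<phi> k z (s k)" for s :: "nat \<Rightarrow> real" and k z
  have det: "deterministic_policy N Y U (\<gamma> s)" if s: "s \<in> space ?\<Lambda>" for s
    unfolding deterministic_policy_def
  proof
    fix k assume k: "k \<in> {1..N}"
    then have "s k \<in> space unit_uniform"
      using s by (auto simp: space_PiM)
    then show "\<gamma> s k \<in> borel_on (Y k) \<rightarrow>\<^sub>M borel_on (U k)"
      using measurable_Pair1[OF \<phi>[OF k]] by (simp add: \<gamma>_def[abs_def])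
  qed
  define F where "F w s = ennreal (c (\<omega>0 w) (\<lambda>k\<in>{1..N}. \<gamma> s k (y k w)))" for w s
  have "(\<lambda>z. \<lambda>k\<in>{1..N}. \<gamma> (snd z) k (y k (fst z))) \<in> P \<Otimes>\<^sub>M ?\<Lambda> \<rightarrow>\<^sub>M borel_prod N U"
  proof (rule measurable_restrict)
    fix k assume k: "k \<in> {1..N}"
    have "(\<lambda>z. (y k (fst z), snd z k)) \<in> P \<Otimes>\<^sub>M ?\<Lambda> \<rightarrow>\<^sub>M borel_on (Y k) \<Otimes>\<^sub>M unit_uniform"
      by (rule measurable_Pair[OF measurable_compose[OF measurable_fst y[OF k]]
            measurable_compose[OF measurable_snd measurable_component_singleton[OF k]]])
    from measurable_compose[OF this \<phi>[OF k]]
    show "(\<lambda>z. \<gamma> (snd z) k (y k (fst z))) \<in> P \<Otimes>\<^sub>M ?\<Lambda> \<rightarrow>\<^sub>M borel_on (U k)"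
      by (simp add: \<gamma>_def)
  qed
  then have "(\<lambda>z. (\<omega>0 (fst z), \<lambda>k\<in>{1..N}. \<gamma> (snd z) k (y k (fst z))))
      \<in> P \<Otimes>\<^sub>M ?\<Lambda> \<rightarrow>\<^sub>M borel_on \<Omega>0 \<Otimes>\<^sub>M borel_prod N U"
    by (intro measurable_Pair measurable_compose[OF measurable_fst \<omega>0])
  from measurable_compose[OF measurable_compose[OF this c] measurable_ennreal]
  have F[measurable]: "(\<lambda>(w, s). F w s) \<in> borel_measurable (P \<Otimes>\<^sub>M ?\<Lambda>)"
    by (simp add: F_def case_prod_beta')
  have "(\<integral>\<^sup>+ u. ennreal (c (\<omega>0 w) u) \<partial>(\<Pi>\<^sub>M k\<in>{1..N}. \<pi> k (y k w))) = (\<integral>\<^sup>+ s. F w s \<partial>?\<Lambda>)"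
    if w: "w \<in> space P" for w
  proof -
    have yw: "y k w \<in> space (borel_on (Y k))" if "k \<in> {1..N}" for k
      using measurable_space[OF y[OF that] w] .
    have \<omega>w: "\<omega>0 w \<in> space (borel_on \<Omega>0)"
      using measurable_space[OF \<omega>0 w] .
    have "(\<Pi>\<^sub>M k\<in>{1..N}. \<pi> k (y k w)) = (\<Pi>\<^sub>M k\<in>{1..N}. distr unit_uniform (borel_on (U k)) (\<phi> k (y k w)))"
      by (rule PiM_cong) (simp_all add: \<phi>_law yw)
    also have "\<dots> = distr ?\<Lambda> (borel_prod N U) (\<lambda>s. \<lambda>k\<in>{1..N}. \<phi> k (y k w) (s k))"
      by (rule PiM_distr_components) (simp_all add: prob_space_unit_uniform \<phi>_section yw)
    finally have law: "(\<Pi>\<^sub>M k\<in>{1..N}. \<pi> k (y k w))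
        = distr ?\<Lambda> (borel_prod N U) (\<lambda>s. \<lambda>k\<in>{1..N}. \<phi> k (y k w) (s k))" .
    have meas: "(\<lambda>s. \<lambda>k\<in>{1..N}. \<phi> k (y k w) (s k)) \<in> ?\<Lambda> \<rightarrow>\<^sub>M borel_prod N U"
    proof (rule measurable_restrict)
      fix k assume k: "k \<in> {1..N}"
      show "(\<lambda>s. \<phi> k (y k w) (s k)) \<in> ?\<Lambda> \<rightarrow>\<^sub>M borel_on (U k)"
        by (rule measurable_compose[OF measurable_component_singleton[OF k] \<phi>_section[OF k yw[OF k]]])
    qed
    have "(\<lambda>u. c (\<omega>0 w) u) \<in> borel_measurable (borel_prod N U)"
      using measurable_Pair2[OF c \<omega>w] by simp
    then show ?thesis
      unfolding law by (subst nn_integral_distr[OF meas]) (simp_all add: F_def[abs_def] \<gamma>_def)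
  qed
  then have "cost_rand N P \<omega>0 y c \<pi> = (\<integral>\<^sup>+ w. (\<integral>\<^sup>+ s. F w s \<partial>?\<Lambda>) \<partial>P)"
    unfolding cost_rand_def by (rule nn_integral_cong)
  also have "\<dots> = (\<integral>\<^sup>+ s. cost_det N P \<omega>0 y c (\<gamma> s) \<partial>?\<Lambda>)"
    unfolding cost_det_def F_def[symmetric] by (rule Fubini'[OF F, symmetric])
  also have "\<dots> \<ge> (\<integral>\<^sup>+ s. (INF \<gamma>\<in>{\<gamma>. deterministic_policy N Y U \<gamma>}. cost_det N P \<omega>0 y c \<gamma>) \<partial>?\<Lambda>)"
    by (intro nn_integral_mono INF_lower) (simp add: det)
  finally show ?thesis
    by (simp only: nn_integral_const \<Lambda>.emeasure_space_1 mult_1_right)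
qed

section \<open>Conditioning the cost on the observations\<close>

text \<open>
  The defining identity of the regular conditional distribution says that two finite measures on
  \<open>\<Omega>0 \<times> \<Prod>Y\<close>, the joint law and the mixture \<open>P \<bind> D\<close> of the conditional laws, agree on rectangles;
  rectangles generate the product \<open>\<sigma>\<close>-algebra.
\<close>

lemma nn_integral_regular_conditional_distribution:
  assumes P: "prob_space P"
    and \<omega>0[measurable]: "\<omega>0 \<in> P \<rightarrow>\<^sub>M borel_on \<Omega>0"
    and tuple[measurable]: "tuple N y \<in> P \<rightarrow>\<^sub>M borel_prod N Y"
    and \<kappa>: "regular_conditional_distribution N P \<Omega>0 \<omega>0 Y y \<kappa>"
    and f[measurable]: "(\<lambda>(x, ys). f x ys) \<in> borel_measurable (borel_on \<Omega>0 \<Otimes>\<^sub>M borel_prod N Y)"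
  shows "(\<integral>\<^sup>+ w. f (\<omega>0 w) (tuple N y w) \<partial>P) = (\<integral>\<^sup>+ w. (\<integral>\<^sup>+ x. f x (tuple N y w) \<partial>\<kappa> (tuple N y w)) \<partial>P)"
proof -
  interpret P: prob_space P by fact
  let ?S = "borel_on \<Omega>0" and ?T = "borel_prod N Y"
  have \<kappa>_meas: "\<kappa> \<in> ?T \<rightarrow>\<^sub>M prob_algebra ?S"
    and \<kappa>_eq: "\<And>A B. A \<in> sets ?S \<Longrightarrow> B \<in> sets ?T \<Longrightarrow>
        emeasure P {w \<in> space P. \<omega>0 w \<in> A \<and> tuple N y w \<in> B} =
          (\<integral>\<^sup>+ w. emeasure (\<kappa> (tuple N y w)) A * indicator B (tuple N y w) \<partial>P)"
    using \<kappa> by (auto simp: regular_conditional_distribution_def)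
  define D where "D w = distr (\<kappa> (tuple N y w)) (?S \<Otimes>\<^sub>M ?T) (\<lambda>x. (x, tuple N y w))" for w
  have D_meas: "D \<in> P \<rightarrow>\<^sub>M prob_algebra (?S \<Otimes>\<^sub>M ?T)"
    unfolding D_def by (rule measurable_distr_prob_space2[OF measurable_compose[OF tuple \<kappa>_meas]]) measurable
  note D_sub = measurable_prob_algebraD[OF D_meas]
  have \<kappa>w: "sets (\<kappa> (tuple N y w)) = sets ?S" if "w \<in> space P" for w
    using measurable_space[OF \<kappa>_meas measurable_space[OF tuple that]] by (simp add: space_prob_algebra)
  have pair: "(\<lambda>x. (x, tuple N y w)) \<in> \<kappa> (tuple N y w) \<rightarrow>\<^sub>M ?S \<Otimes>\<^sub>M ?T" if "w \<in> space P" for w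
    using measurable_space[OF tuple that] unfolding measurable_cong_sets[OF \<kappa>w[OF that] refl]
    by measurable
  have joint: "(\<lambda>w. (\<omega>0 w, tuple N y w)) \<in> P \<rightarrow>\<^sub>M ?S \<Otimes>\<^sub>M ?T"
    by (rule measurable_Pair[OF \<omega>0 tuple])
  let ?E = "{a \<times> b |a b. a \<in> sets ?S \<and> b \<in> sets ?T}"
  have "distr P (?S \<Otimes>\<^sub>M ?T) (\<lambda>w. (\<omega>0 w, tuple N y w)) = P \<bind> D"
  proof (rule measure_eqI_generator_eq[where E="?E" and \<Omega>="space ?S \<times> space ?T"
        and A="\<lambda>_. space ?S \<times> space ?T"])
    show "Int_stable ?E"
      by (rule Int_stable_pair_measure_generator)
    show "?E \<subseteq> Pow (space ?S \<times> space ?T)"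
      by (auto dest: sets.sets_into_space)
    show "sets (distr P (?S \<Otimes>\<^sub>M ?T) (\<lambda>w. (\<omega>0 w, tuple N y w))) = sigma_sets (space ?S \<times> space ?T) ?E"
      by (simp add: sets_pair_measure)
    show "sets (P \<bind> D) = sigma_sets (space ?S \<times> space ?T) ?E"
      using sets_bind[OF sets_kernel[OF D_sub] P.not_empty] by (simp add: sets_pair_measure)
    show "range (\<lambda>_. space ?S \<times> space ?T) \<subseteq> ?E"
      by auto
    show "emeasure (distr P (?S \<Otimes>\<^sub>M ?T) (\<lambda>w. (\<omega>0 w, tuple N y w))) (space ?S \<times> space ?T) \<noteq> \<infinity>"
      by (subst emeasure_distr[OF joint]) simp_all
    fix X assume "X \<in> ?E"
    then obtain A B where X: "X = A \<times> B" and A: "A \<in> sets ?S" and B: "B \<in> sets ?T"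
      by blast
    have AB: "A \<times> B \<in> sets (?S \<Otimes>\<^sub>M ?T)"
      by (rule pair_measureI[OF A B])
    have "emeasure (distr P (?S \<Otimes>\<^sub>M ?T) (\<lambda>w. (\<omega>0 w, tuple N y w))) X
        = emeasure P {w \<in> space P. \<omega>0 w \<in> A \<and> tuple N y w \<in> B}"
      unfolding X by (subst emeasure_distr[OF joint AB]) (auto intro!: arg_cong[where f="emeasure P"])
    also have "\<dots> = (\<integral>\<^sup>+ w. emeasure (\<kappa> (tuple N y w)) A * indicator B (tuple N y w) \<partial>P)"
      by (rule \<kappa>_eq[OF A B])
    also have "\<dots> = (\<integral>\<^sup>+ w. emeasure (D w) X \<partial>P)"
    proof (rule nn_integral_cong)
      fix w assume w: "w \<in> space P"
      have "(\<lambda>x. (x, tuple N y w)) -` (A \<times> B) \<inter> space (\<kappa> (tuple N y w))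
          = (if tuple N y w \<in> B then A else {})"
        using sets.sets_into_space[OF A] sets_eq_imp_space_eq[OF \<kappa>w[OF w]] by auto
      then show "emeasure (\<kappa> (tuple N y w)) A * indicator B (tuple N y w) = emeasure (D w) X"
        unfolding D_def X by (subst emeasure_distr[OF pair[OF w] AB]) auto
    qed
    also have "\<dots> = emeasure (P \<bind> D) X"
      unfolding X by (rule emeasure_bind[OF P.not_empty D_sub AB, symmetric])
    finally show "emeasure (distr P (?S \<Otimes>\<^sub>M ?T) (\<lambda>w. (\<omega>0 w, tuple N y w))) X = emeasure (P \<bind> D) X" .
  qed auto
  then have eq: "(\<integral>\<^sup>+ z. (case z of (x, ys) \<Rightarrow> f x ys) \<partial>distr P (?S \<Otimes>\<^sub>M ?T) (\<lambda>w. (\<omega>0 w, tuple N y w)))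
      = (\<integral>\<^sup>+ w. (\<integral>\<^sup>+ z. (case z of (x, ys) \<Rightarrow> f x ys) \<partial>D w) \<partial>P)"
    using nn_integral_bind[OF f D_sub] by simp
  have "(\<integral>\<^sup>+ z. (case z of (x, ys) \<Rightarrow> f x ys) \<partial>D w) = (\<integral>\<^sup>+ x. f x (tuple N y w) \<partial>\<kappa> (tuple N y w))"
    if "w \<in> space P" for w
    unfolding D_def by (subst nn_integral_distr[OF pair[OF that]]) (simp_all only: measurable_distr_eq1 f prod.case)
  then have "(\<integral>\<^sup>+ w. (\<integral>\<^sup>+ z. (case z of (x, ys) \<Rightarrow> f x ys) \<partial>D w) \<partial>P)
      = (\<integral>\<^sup>+ w. (\<integral>\<^sup>+ x. f x (tuple N y w) \<partial>\<kappa> (tuple N y w)) \<partial>P)"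
    by (rule nn_integral_cong)
  with eq show ?thesis
    by (simp only: nn_integral_distr[OF joint] measurable_distr_eq1 f prod.case)
qed

lemma measurable_tuple:
  "(\<And>k. k \<in> {1..N} \<Longrightarrow> y k \<in> P \<rightarrow>\<^sub>M borel_on (Y k)) \<Longrightarrow> tuple N y \<in> P \<rightarrow>\<^sub>M borel_prod N Y"
  unfolding tuple_def by (rule measurable_restrict)

lemma cost_det_eq_conditional_cost:
  assumes P: "prob_space P"
    and \<omega>0: "\<omega>0 \<in> P \<rightarrow>\<^sub>M borel_on \<Omega>0"
    and y: "\<And>k. k \<in> {1..N} \<Longrightarrow> y k \<in> P \<rightarrow>\<^sub>M borel_on (Y k)"
    and c: "(\<lambda>(x, us). c x us) \<in> borel_measurable (borel_on \<Omega>0 \<Otimes>\<^sub>M borel_prod N U)"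
    and \<kappa>: "regular_conditional_distribution N P \<Omega>0 \<omega>0 Y y \<kappa>"
    and \<gamma>: "deterministic_policy N Y U \<gamma>"
  shows "cost_det N P \<omega>0 y c \<gamma>
      = (\<integral>\<^sup>+ w. conditional_cost c \<kappa> (tuple N y w) (\<lambda>k\<in>{1..N}. \<gamma> k (y k w)) \<partial>P)"
proof -
  define f where "f x ys = ennreal (c x (\<lambda>k\<in>{1..N}. \<gamma> k (ys k)))" for x ys
  have "(\<lambda>ys. \<lambda>k\<in>{1..N}. \<gamma> k (ys k)) \<in> borel_prod N Y \<rightarrow>\<^sub>M borel_prod N U"
    using \<gamma> unfolding deterministic_policy_def
    by (intro measurable_restrict measurable_compose[OF measurable_component_singleton]) auto
  from measurable_compose[OF measurable_snd this]
  have "(\<lambda>z. (fst z, \<lambda>k\<in>{1..N}. \<gamma> k (snd z k)))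
      \<in> borel_on \<Omega>0 \<Otimes>\<^sub>M borel_prod N Y \<rightarrow>\<^sub>M borel_on \<Omega>0 \<Otimes>\<^sub>M borel_prod N U"
    by (rule measurable_Pair[OF measurable_fst])
  from measurable_compose[OF measurable_compose[OF this c] measurable_ennreal]
  have f_meas: "(\<lambda>(x, ys). f x ys) \<in> borel_measurable (borel_on \<Omega>0 \<Otimes>\<^sub>M borel_prod N Y)"
    by (simp add: f_def case_prod_beta')
  have f_tuple: "f x (tuple N y w) = ennreal (c x (\<lambda>k\<in>{1..N}. \<gamma> k (y k w)))" for x w
    by (simp add: f_def tuple_def cong: restrict_cong)
  show ?thesis
    using nn_integral_regular_conditional_distribution[OF P \<omega>0 measurable_tuple[OF y] \<kappa> f_meas]
    unfolding f_tuple cost_det_def conditional_cost_def by simp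
qed

lemma measurable_conditional_cost:
  assumes \<kappa>: "\<kappa> \<in> borel_prod N Y \<rightarrow>\<^sub>M prob_algebra (borel_on \<Omega>0)"
    and c: "(\<lambda>(x, us). c x us) \<in> borel_measurable (borel_on \<Omega>0 \<Otimes>\<^sub>M borel_prod N U)"
  shows "(\<lambda>(ys, us). conditional_cost c \<kappa> ys us) \<in> borel_measurable (borel_prod N Y \<Otimes>\<^sub>M borel_prod N U)"
proof -
  let ?YU = "borel_prod N Y \<Otimes>\<^sub>M borel_prod N U"
  have "(\<lambda>p. (snd p, snd (fst p))) \<in> ?YU \<Otimes>\<^sub>M borel_on \<Omega>0 \<rightarrow>\<^sub>M borel_on \<Omega>0 \<Otimes>\<^sub>M borel_prod N U"
    by measurable
  from measurable_compose[OF measurable_compose[OF this c] measurable_ennreal]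
  have "(\<lambda>(z, x). ennreal (c x (snd z))) \<in> borel_measurable (?YU \<Otimes>\<^sub>M borel_on \<Omega>0)"
    by (simp add: case_prod_beta')
  from nn_integral_measurable_subprob_algebra2[OF this
      measurable_prob_algebraD[OF measurable_compose[OF measurable_fst \<kappa>]]]
  show ?thesis
    by (simp add: conditional_cost_def case_prod_beta')
qed

text \<open>Topological lower semicontinuity implies the sequential form that pairs with Fatou's lemma.\<close>

lemma lower_semicontinuous_map_liminf:
  assumes f: "lower_semicontinuous_map X f" and lim: "limitin X s l sequentially"
  shows "f l \<le> liminf (\<lambda>m. f (s m))"
  unfolding le_Liminf_iff
proof (intro allI impI)
  fix a assume "a < f l"
  then have "l \<in> {x \<in> topspace X. a < f x}"
    using limitin_topspace[OF lim] by simp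
  then have "\<forall>\<^sub>F m in sequentially. s m \<in> {x \<in> topspace X. a < f x}"
    using lim f unfolding limitin_def lower_semicontinuous_map_def by blast
  then show "\<forall>\<^sub>F m in sequentially. a < f (s m)"
    by (auto elim: eventually_mono)
qed

section \<open>Existence of an optimal policy\<close>

text \<open>An empty factor would make the whole product compact without any condition on the others.\<close>

lemma compact_factors:
  assumes "compact_space (product_topology (\<lambda>k. prod_topology (top_of_set (Y k)) (top_of_set (U k))) I)"
    and Y: "\<And>k. k \<in> I \<Longrightarrow> Y k \<noteq> {}" and U: "\<And>k. k \<in> I \<Longrightarrow> U k \<noteq> {}" and k: "k \<in> I"
  shows "compact (U k)"
proof -
  have "compact_space (prod_topology (top_of_set (Y k)) (top_of_set (U k)))"
  proof -
    have "topspace (product_topology (\<lambda>k. prod_topology (top_of_set (Y k)) (top_of_set (U k))) I) \<noteq> {}"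
      using Y U by (simp add: PiE_eq_empty_iff)
    then show ?thesis
      using assms(1) k unfolding compact_space_product_topology null_topspace_iff_trivial by blast
  qed
  then have "compact_space (top_of_set (U k))"
    using Y[OF k] U[OF k] unfolding compact_space_prod_topology null_topspace_iff_trivial[symmetric]
    by auto
  then show ?thesis
    by (metis compactin_euclidean_iff compactin_subspace subset_UNIV topspace_euclidean)
qed

theorem theorem5p6:
  fixes N :: nat
    and P :: "'w measure"
    and \<Omega>0 :: "'o::polish_space set"
    and \<omega>0 :: "'w \<Rightarrow> 'o"
    and Y :: "nat \<Rightarrow> 'y::polish_space set"
    and y :: "nat \<Rightarrow> 'w \<Rightarrow> 'y"
    and U :: "nat \<Rightarrow> 'u::polish_space set"
    and c :: "'o \<Rightarrow> (nat \<Rightarrow> 'u) \<Rightarrow> real"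
    and \<kappa> :: "(nat \<Rightarrow> 'y) \<Rightarrow> 'o measure"
  assumes "prob_space P"
    and "\<Omega>0 \<in> sets borel"
    and "\<And>k. k \<in> {1..N} \<Longrightarrow> Y k \<in> sets borel"
    and "\<And>k. k \<in> {1..N} \<Longrightarrow> U k \<in> sets borel"
    and "\<And>k. k \<in> {1..N} \<Longrightarrow> U k \<noteq> {}"
    and "\<omega>0 \<in> P \<rightarrow>\<^sub>M borel_on \<Omega>0"
    and "\<And>k. k \<in> {1..N} \<Longrightarrow> y k \<in> P \<rightarrow>\<^sub>M borel_on (Y k)"
    and "(\<lambda>(x, us). c x us) \<in> borel_measurable (borel_on \<Omega>0 \<Otimes>\<^sub>M borel_prod N U)"
    and "\<And>x us. x \<in> \<Omega>0 \<Longrightarrow> us \<in> (\<Pi>\<^sub>E k\<in>{1..N}. U k) \<Longrightarrow> 0 \<le> c x us"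
    and "expanding_information N P Y y"
    and "compact_space
           (product_topology (\<lambda>k. prod_topology (top_of_set (Y k)) (top_of_set (U k))) {1..N})"
    and "regular_conditional_distribution N P \<Omega>0 \<omega>0 Y y \<kappa>"
    and "\<And>ys. ys \<in> (\<Pi>\<^sub>E k\<in>{1..N}. Y k) \<Longrightarrow>
           lower_semicontinuous_map (product_topology (\<lambda>k. top_of_set (U k)) {1..N})
             (conditional_cost c \<kappa> ys)"
  shows "\<exists>\<gamma>. optimal_deterministic_policy N P \<omega>0 Y y U c \<gamma>"
proof -
  note P = assms(1) and U = assms(4) and U_ne = assms(5) and \<omega>0 = assms(6) and y = assms(7)
    and c = assms(8) and expanding = assms(10) and \<kappa> = assms(12) and lsc = assms(13)
  interpret P: prob_space P by (rule P)
  let ?J = "cost_det N P \<omega>0 y c" and ?D = "{\<gamma>. deterministic_policy N Y U \<gamma>}"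
  let ?cost = "conditional_cost c \<kappa>"

  have Y_ne: "Y k \<noteq> {}" if "k \<in> {1..N}" for k
    using P.not_empty measurable_space[OF y[OF that]] by (auto simp: space_restrict_space)
  have U_compact: "compact (U k)" if "k \<in> {1..N}" for k
    by (rule compact_factors[OF assms(11) Y_ne U_ne that])
  have "\<exists>u0. \<forall>k\<in>{1..N}. u0 k \<in> U k"
    using U_ne by (intro bchoice) blast
  then obtain u0 where u0: "\<And>k. k \<in> {1..N} \<Longrightarrow> u0 k \<in> U k"
    by blast
  have "(\<lambda>k _. u0 k) \<in> ?D"
    using u0 by (simp add: deterministic_policy_def space_restrict_space)
  then have "?J ` ?D \<noteq> {}"
    by blast
  then obtain J where J: "decseq J" "range J \<subseteq> ?J ` ?D" "Inf (?J ` ?D) = (INF j. J j)"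
    by (rule ennreal_Inf_countable_INF[THEN exE]) blast
  then have "\<exists>\<gamma>. deterministic_policy N Y U \<gamma> \<and> J j = ?J \<gamma>" for j
    by blast
  then obtain \<Gamma> where \<Gamma>: "\<And>j. deterministic_policy N Y U (\<Gamma> j)" and J_eq: "\<And>j. J j = ?J (\<Gamma> j)"
    by metis
  have J_lim: "liminf J = Inf (?J ` ?D)"
    unfolding J(3) by (rule lim_imp_Liminf[OF _ LIMSEQ_INF[OF J(1)]]) simp

  define G where "G k = vimage_algebra (space P) (y k) (borel_on (Y k))" for k
  have y_space: "y k \<in> space P \<rightarrow> space (borel_on (Y k))" if "k \<in> {1..N}" for k
    using measurable_space[OF y[OF that]] by blast
  have y_G: "y k \<in> G k \<rightarrow>\<^sub>M borel_on (Y k)" if "k \<in> {1..N}" for k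
    unfolding G_def by (rule measurable_vimage_algebra1[OF y_space[OF that]])
  have G: "subalgebra P (G k)" if "k \<in> {1..N}" for k
    using measurable_sets[OF y[OF that]]
    by (auto simp: subalgebra_def G_def sets_vimage_algebra2[OF y_space[OF that]])
  have G_mono: "sets (G k) \<subseteq> sets (G (Suc k))" if "k \<in> {1..<N}" for k
    using expanding that by (simp add: expanding_information_def sigma_of_def G_def)

  define v where "v j k w = \<Gamma> j k (y k w)" for j k w
  have \<Gamma>_meas: "\<Gamma> j k \<in> borel_on (Y k) \<rightarrow>\<^sub>M borel_on (U k)" if "k \<in> {1..N}" for j k
    using \<Gamma>[of j] that by (simp add: deterministic_policy_def)
  have v_G: "v j k \<in> G k \<rightarrow>\<^sub>M borel_on (U k)" if "k \<in> {1..N}" for j k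
    unfolding v_def by (rule measurable_compose[OF y_G[OF that] \<Gamma>_meas[OF that]])
  have v_borel: "v j k \<in> borel_measurable (G k)" if "k \<in> {1..N}" for j k
    using v_G[OF that] by (simp add: measurable_restrict_space2_iff)
  have v_P: "v j k \<in> P \<rightarrow>\<^sub>M borel_on (U k)" if "k \<in> {1..N}" for j k
    by (rule measurable_from_subalg[OF G[OF that] v_G[OF that]])
  have v_U: "v j k w \<in> U k" if "k \<in> {1..N}" "w \<in> space P" for j k w
    using measurable_space[OF v_P[OF that(1)] that(2)] by (simp add: space_restrict_space)

  define X where "X j w = ?cost (tuple N y w) (\<lambda>k\<in>{1..N}. v j k w)" for j w
  have tuple: "tuple N y \<in> P \<rightarrow>\<^sub>M borel_prod N Y"
    by (rule measurable_tuple[OF y])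
  have X: "X j \<in> borel_measurable P" for j
  proof -
    have "(\<lambda>w. (tuple N y w, \<lambda>k\<in>{1..N}. v j k w)) \<in> P \<rightarrow>\<^sub>M borel_prod N Y \<Otimes>\<^sub>M borel_prod N U"
      by (intro measurable_Pair tuple measurable_restrict v_P)
    from measurable_compose[OF this measurable_conditional_cost[OF _ c]] \<kappa> show ?thesis
      by (simp add: X_def[abs_def] regular_conditional_distribution_def)
  qed
  have J_X: "J j = (\<integral>\<^sup>+ w. X j w \<partial>P)" for j
    unfolding J_eq X_def v_def by (rule cost_det_eq_conditional_cost[OF P \<omega>0 y c \<kappa> \<Gamma>])

  obtain \<sigma> l where \<sigma>: "\<And>m. \<sigma> m \<in> P \<rightarrow>\<^sub>M count_space UNIV"
    and l: "\<And>k. k \<in> {1..N} \<Longrightarrow> l k \<in> borel_measurable (G k)"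
      "\<And>k w. k \<in> {1..N} \<Longrightarrow> w \<in> space P \<Longrightarrow> l k w \<in> U k"
      "\<And>k w. k \<in> {1..N} \<Longrightarrow> w \<in> space P \<Longrightarrow> (\<lambda>m. v (\<sigma> m w) k w) \<longlonglongrightarrow> l k w"
    and liminf_X: "liminf (\<lambda>m. \<integral>\<^sup>+ w. X (\<sigma> m w) w \<partial>P) \<le> liminf (\<lambda>m. \<integral>\<^sup>+ w. X m w \<partial>P)"
    by (rule adapted_subsequence[where v=v and X=X and K=U and G=G,
          OF P G G_mono X U_compact v_borel v_U])
      (assumption+, rule that, assumption+)

  have "\<exists>h. h \<in> borel_measurable (borel_on (Y k)) \<and> (\<forall>w\<in>space P. h (y k w) = l k w)"
    if k: "k \<in> {1..N}" for k
    using doob_dynkin_factorization[OF y_space[OF k] l(1)[OF k, unfolded G_def]] by metis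
  then obtain h where h: "\<And>k. k \<in> {1..N} \<Longrightarrow> h k \<in> borel_measurable (borel_on (Y k))"
    "\<And>k w. k \<in> {1..N} \<Longrightarrow> w \<in> space P \<Longrightarrow> h k (y k w) = l k w"
    by metis
  \<comment> \<open>off the range of \<open>y k\<close> the factor \<open>h k\<close> may leave \<open>U k\<close>\<close>
  define \<gamma> where "\<gamma> k z = (if h k z \<in> U k then h k z else u0 k)" for k z
  have \<gamma>: "deterministic_policy N Y U \<gamma>"
    unfolding deterministic_policy_def
  proof
    fix k assume k: "k \<in> {1..N}"
    note [measurable] = U[OF k] h(1)[OF k]
    show "\<gamma> k \<in> borel_on (Y k) \<rightarrow>\<^sub>M borel_on (U k)"
      unfolding \<gamma>_def by (rule measurable_restrict_space2) (use u0[OF k] in auto)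
  qed
  have \<gamma>_l: "\<gamma> k (y k w) = l k w" if "k \<in> {1..N}" "w \<in> space P" for k w
    using h(2)[OF that] l(2)[OF that] by (simp add: \<gamma>_def)

  have "?J \<gamma> = (\<integral>\<^sup>+ w. ?cost (tuple N y w) (\<lambda>k\<in>{1..N}. \<gamma> k (y k w)) \<partial>P)"
    by (rule cost_det_eq_conditional_cost[OF P \<omega>0 y c \<kappa> \<gamma>])
  also have "\<dots> \<le> (\<integral>\<^sup>+ w. liminf (\<lambda>m. X (\<sigma> m w) w) \<partial>P)"
  proof (rule nn_integral_mono)
    fix w assume w: "w \<in> space P"
    have "tuple N y w \<in> (\<Pi>\<^sub>E k\<in>{1..N}. Y k)"
      using measurable_space[OF tuple w] by (simp add: space_PiM space_restrict_space)
    moreover have "limitin (product_topology (\<lambda>k. top_of_set (U k)) {1..N})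
        (\<lambda>m. \<lambda>k\<in>{1..N}. v (\<sigma> m w) k w) (\<lambda>k\<in>{1..N}. \<gamma> k (y k w)) sequentially"
      using l(2,3) v_U w by (auto simp: limitin_componentwise limitin_subtopology \<gamma>_l)
    ultimately show "?cost (tuple N y w) (\<lambda>k\<in>{1..N}. \<gamma> k (y k w)) \<le> liminf (\<lambda>m. X (\<sigma> m w) w)"
      unfolding X_def by (rule lower_semicontinuous_map_liminf[OF lsc])
  qed
  also have "\<dots> \<le> liminf (\<lambda>m. \<integral>\<^sup>+ w. X (\<sigma> m w) w \<partial>P)"
    by (intro nn_integral_liminf measurable_compose_countable[OF X \<sigma>])
  also have "\<dots> \<le> Inf (?J ` ?D)"
    using liminf_X by (simp add: J_X[symmetric] J_lim)
  finally have \<gamma>_opt: "?J \<gamma> \<le> Inf (?J ` ?D)" .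

  have "?J \<gamma> \<le> cost_rand N P \<omega>0 y c \<pi>" if "randomized_policy N Y U \<pi>" for \<pi>
    using \<gamma>_opt cost_rand_ge_INF_cost_det[OF P U U_ne \<omega>0 y c that] by (rule order_trans)
  moreover have "?J \<gamma> \<le> ?J \<gamma>'" if "deterministic_policy N Y U \<gamma>'" for \<gamma>'
    using \<gamma>_opt by (rule order_trans) (use that in \<open>auto intro: INF_lower\<close>)
  ultimately have "?J \<gamma> = Inf (?J ` ?D \<union> cost_rand N P \<omega>0 y c ` {\<pi>. randomized_policy N Y U \<pi>})"
    using \<gamma> by (intro antisym Inf_greatest Inf_lower) auto
  with \<gamma> show ?thesis
    unfolding optimal_deterministic_policy_def by blast
qed

end
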